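(* In a pre-Hilbert $*$-category that is monotone complete and orthogonally complete, every $\ell^2$-biproduct is an $\ell^2$-product.
   Context: A $*$-category is a category equipped with a choice of morphism $f^*\colon Y\to X$ for each morphism $f\colon X\to Y$ such that $1^*=1$, $(gf)^*=f^*g^*$ and $(f^* )^*=f$. A morphism $f$ is an isometry if $f^*f=1$, and a coisometry if $ff^*=1$. In a $*$-category with a zero object, a binary product $(r_1\colon X\to X_1,\ r_2\colon X\to X_2)$ is orthonormal if $r_1,r_2$ are coisometries and $r_1r_2^*=0$. A pre-Hilbert $*$-category is a $*$-category with a zero object, in which every pair of objects has an orthonormal product (written $X_1\oplus X_2$), every morphism has a kernel that is an isometry, and, for each object $X$, the diagonal $X\to X\oplus X$ (with both components $1$) is a kernel of some morphism. It is known that every pre-Hilbert $*$-category $\mathbf{C}$ is canonically enriched in rational vector spaces, with $(f+g)^*=f^*+g^*$, orthonormal products being biproducts. For each object $A$, the Hermitian elements ($a^*=a$) of $\mathbf{C}(A,A)$ are partially ordered by: $f\le g$ iff $g-f=h^*h$ for some morphism $h\colon A\to X$. A directed set is a non-empty preordered set in which every pair of elements has an upper bound. An increasing net in $\mathbf{C}(A,A)$ is a family $(a_j)_{j\in J}$ of Hermitian elements indexed by a directed set with $a_j\le a_k$ whenever $j\le k$. $\mathbf{C}$ is monotone complete if, for each object $A$, every increasing net in $\mathbf{C}(A,A)$ with an upper bound has a supremum (least upper bound). For a set $J$, $\mathcal{F}J$ is the set of finite subsets of $J$, directed by inclusion. For a family $(a_j)_{j\in J}$ of positive elements ($a_j\ge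 0$) of $\mathbf{C}(A,A)$, $\sum_{j\in J}a_j$ denotes $\sup_{F\in\mathcal{F}J}\sum_{j\in F}a_j$ (if it exists). An $\ell^2$-family in $\mathbf{C}(A,X)$ is a family $(x_j)_{j\in J}$ of morphisms $x_j\colon A\to X$ with $x_j^*x_k=0$ for $j\neq k$ and such that the net $(\sum_{j\in F}x_j^*x_j)_{F\in\mathcal{F}J}$ is bounded above in $\mathbf{C}(A,A)$. An order sum of such a family is a morphism $s\colon A\to X$ with $s^*x_j=x_j^*x_j$ for each $j\in J$ and $s^*s=\sum_{j\in J}x_j^*x_j$ (in particular this supremum exists). $\mathbf{C}$ is orthogonally complete if, for all objects $A,X$, every $\ell^2$-family in $\mathbf{C}(A,X)$ has an order sum. Let $(X_j)_{j\in J}$ be a family of objects of $\mathbf{C}$. An $\ell^2$-span on it is a span $(g_j\colon Y\to X_j)_{j\in J}$ such that the net $(\sum_{j\in F}g_j^*g_j)_{F\in\mathcal{F}J}$ in $\mathbf{C}(Y,Y)$ is bounded above. An $\ell^2$-product of $(X_j)_{j\in J}$ is an $\ell^2$-span $(r_j\colon X\to X_j)_{j\in J}$ such that for all $\ell^2$-spans $(g_j\colon Y\to X_j)_{j\in J}$ there is a unique morphism $g\colon Y\to X$ with $r_jg=g_j$ for all $j\in J$, and this $g$ satisfies $g^*g=\sum_{j\in J}g_j^*g_j$. An $\ell^2$-biproduct of $(X_j)_{j\in J}$ is a span $(r_j\colon X\to X_j)_{j\in J}$ such that, for all $j,k\in J$, $r_jr_k^*=1$ if $j=k$ and $r_jr_k^*=0$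 otherwise, and $\sum_{j\in J}r_j^*r_j=1$. *)

theory Defs
  imports "HOL-Algebra.Ring" "HOL-Algebra.Lattice"
begin

section \<open>Categories with involution\<close>

text \<open>Only the values of the operations on objects in \<open>Ob\<close> and on (composable) morphisms in
  \<open>Mor\<close> are meaningful; \<open>g \<cdot> f\<close> is composition in the usual order, \<open>f\<close> first.\<close>

record ('o, 'm) star_cat =
  Ob :: "'o set"
  Mor :: "'m set"
  Dom :: "'m \<Rightarrow> 'o"
  Cod :: "'m \<Rightarrow> 'o"
  Ident :: "'o \<Rightarrow> 'm"
  Comp :: "'m \<Rightarrow> 'm \<Rightarrow> 'm"  (infixl "\<cdot>\<index>" 70)
  Star :: "'m \<Rightarrow> 'm"

definition homset :: "('o, 'm) star_cat \<Rightarrow> 'o \<Rightarrow> 'o \<Rightarrow> 'm set" where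
  "homset C X Y = {f \<in> Mor C. Dom C f = X \<and> Cod C f = Y}"

locale category =
  fixes C :: "('o, 'm) star_cat" (structure)
  assumes Dom_in_Ob: "f \<in> Mor C \<Longrightarrow> Dom C f \<in> Ob C"
    and Cod_in_Ob: "f \<in> Mor C \<Longrightarrow> Cod C f \<in> Ob C"
    and Ident_in_homset: "X \<in> Ob C \<Longrightarrow> Ident C X \<in> homset C X X"
    and Comp_in_homset: "\<lbrakk>f \<in> homset C X Y; g \<in> homset C Y Z\<rbrakk> \<Longrightarrow> g \<cdot> f \<in> homset C X Z"
    and Comp_Ident: "f \<in> homset C X Y \<Longrightarrow> f \<cdot> Ident C X = f"
    and Ident_Comp: "f \<in> homset C X Y \<Longrightarrow> Ident C Y \<cdot> f = f"
    and Comp_assoc: "\<lbrakk>f \<in> homset C W X; g \<in> homset C X Y; h \<in> homset C Y Z\<rbrakk>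
           \<Longrightarrow> (h \<cdot> g) \<cdot> f = h \<cdot> (g \<cdot> f)"

locale star_category = category +
  assumes Star_in_homset: "f \<in> homset C X Y \<Longrightarrow> Star C f \<in> homset C Y X"
    and Star_Ident: "X \<in> Ob C \<Longrightarrow> Star C (Ident C X) = Ident C X"
    and Star_Comp: "\<lbrakk>f \<in> homset C X Y; g \<in> homset C Y Z\<rbrakk>
           \<Longrightarrow> Star C (g \<cdot> f) = Star C f \<cdot> Star C g"
    and Star_Star: "f \<in> Mor C \<Longrightarrow> Star C (Star C f) = f"

definition isometry :: "('o, 'm) star_cat \<Rightarrow> 'm \<Rightarrow> bool" where
  "isometry C f \<longleftrightarrow> f \<in> Mor C \<and> Star C f \<cdot>\<^bsub>C\<^esub> f = Ident C (Dom C f)"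

definition coisometry :: "('o, 'm) star_cat \<Rightarrow> 'm \<Rightarrow> bool" where
  "coisometry C f \<longleftrightarrow> f \<in> Mor C \<and> f \<cdot>\<^bsub>C\<^esub> Star C f = Ident C (Cod C f)"

definition zero_object :: "('o, 'm) star_cat \<Rightarrow> 'o \<Rightarrow> bool" where
  "zero_object C Z \<longleftrightarrow> Z \<in> Ob C \<and>
     (\<forall>X\<in>Ob C. (\<exists>!f. f \<in> homset C X Z) \<and> (\<exists>!f. f \<in> homset C Z X))"

definition zero_mor :: "('o, 'm) star_cat \<Rightarrow> 'o \<Rightarrow> 'o \<Rightarrow> 'm" where
  "zero_mor C X Y = (THE f. \<exists>Z u v. zero_object C Z \<and>
     u \<in> homset C X Z \<and> v \<in> homset C Z Y \<and> f = v \<cdot>\<^bsub>C\<^esub> u)"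

definition kernel_of :: "('o, 'm) star_cat \<Rightarrow> 'm \<Rightarrow> 'm \<Rightarrow> bool" where
  "kernel_of C f k \<longleftrightarrow> f \<in> Mor C \<and> k \<in> Mor C \<and> Cod C k = Dom C f \<and>
     f \<cdot>\<^bsub>C\<^esub> k = zero_mor C (Dom C k) (Cod C f) \<and>
     (\<forall>Y\<in>Ob C. \<forall>g\<in>homset C Y (Dom C f). f \<cdot>\<^bsub>C\<^esub> g = zero_mor C Y (Cod C f) \<longrightarrow>
        (\<exists>!h. h \<in> homset C Y (Dom C k) \<and> k \<cdot>\<^bsub>C\<^esub> h = g))"

definition binary_product ::
    "('o, 'm) star_cat \<Rightarrow> 'o \<Rightarrow> 'o \<Rightarrow> 'o \<Rightarrow> 'm \<Rightarrow> 'm \<Rightarrow> bool" where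
  "binary_product C X1 X2 P r1 r2 \<longleftrightarrow> r1 \<in> homset C P X1 \<and> r2 \<in> homset C P X2 \<and>
     (\<forall>Y\<in>Ob C. \<forall>g1\<in>homset C Y X1. \<forall>g2\<in>homset C Y X2.
        \<exists>!g. g \<in> homset C Y P \<and> r1 \<cdot>\<^bsub>C\<^esub> g = g1 \<and> r2 \<cdot>\<^bsub>C\<^esub> g = g2)"

definition orthonormal_product ::
    "('o, 'm) star_cat \<Rightarrow> 'o \<Rightarrow> 'o \<Rightarrow> 'o \<Rightarrow> 'm \<Rightarrow> 'm \<Rightarrow> bool" where
  "orthonormal_product C X1 X2 P r1 r2 \<longleftrightarrow> binary_product C X1 X2 P r1 r2 \<and>
     coisometry C r1 \<and> coisometry C r2 \<and> r1 \<cdot>\<^bsub>C\<^esub> Star C r2 = zero_mor C X2 X1"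

text \<open>Orthonormal products are unique up to unitary isomorphism, so in \<open>diagonal_kernel\<close> it makes
  no difference which orthonormal product of \<open>X\<close> with itself is used.\<close>

locale pre_hilbert_star_category = star_category +
  assumes ex_zero_object: "\<exists>Z. zero_object C Z"
    and ex_orthonormal_product: "\<lbrakk>X1 \<in> Ob C; X2 \<in> Ob C\<rbrakk>
           \<Longrightarrow> \<exists>P r1 r2. orthonormal_product C X1 X2 P r1 r2"
    and ex_isometric_kernel: "f \<in> Mor C \<Longrightarrow> \<exists>k. kernel_of C f k \<and> isometry C k"
    and diagonal_kernel: "\<lbrakk>X \<in> Ob C; orthonormal_product C X X P r1 r2;
           d \<in> homset C X P; r1 \<cdot> d = Ident C X; r2 \<cdot> d = Ident C X\<rbrakk>
           \<Longrightarrow> \<exists>f. kernel_of C f d"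


section \<open>Addition and order of morphisms\<close>

text \<open>The canonical addition \<open>f + g = \<nabla> \<langle>f, g\<rangle>\<close> of \<open>f, g : X \<rightarrow> Y\<close>, computed in an orthonormal
  product \<open>(r1, r2)\<close> of \<open>Y\<close> with itself. The product is a biproduct with injections \<open>r1*\<close>
  and \<open>r2*\<close>, so the codiagonal \<open>\<nabla>\<close> is the adjoint \<open>d*\<close> of the diagonal.\<close>

definition mor_add :: "('o, 'm) star_cat \<Rightarrow> 'm \<Rightarrow> 'm \<Rightarrow> 'm" where
  "mor_add C f g = (THE h. \<exists>P r1 r2 d u.
     orthonormal_product C (Cod C f) (Cod C f) P r1 r2 \<and>
     d \<in> homset C (Cod C f) P \<and> r1 \<cdot>\<^bsub>C\<^esub> d = Ident C (Cod C f) \<and> r2 \<cdot>\<^bsub>C\<^esub> d = Ident C (Cod C f) \<and>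
     u \<in> homset C (Dom C f) P \<and> r1 \<cdot>\<^bsub>C\<^esub> u = f \<and> r2 \<cdot>\<^bsub>C\<^esub> u = g \<and>
     h = Star C d \<cdot>\<^bsub>C\<^esub> u)"

definition End :: "('o, 'm) star_cat \<Rightarrow> 'o \<Rightarrow> 'm ring" where
  "End C A = \<lparr>carrier = homset C A A, mult = Comp C, one = Ident C A,
     zero = zero_mor C A A, add = mor_add C\<rparr>"

definition hermitian :: "('o, 'm) star_cat \<Rightarrow> 'o \<Rightarrow> 'm \<Rightarrow> bool" where
  "hermitian C A a \<longleftrightarrow> a \<in> homset C A A \<and> Star C a = a"

definition herm_order :: "('o, 'm) star_cat \<Rightarrow> 'o \<Rightarrow> 'm gorder" where
  "herm_order C A = \<lparr>carrier = {a. hermitian C A a}, eq = (=),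
     le = (\<lambda>f g. hermitian C A f \<and> hermitian C A g \<and>
             (\<exists>X\<in>Ob C. \<exists>h\<in>homset C A X. g \<ominus>\<^bsub>End C A\<^esub> f = Star C h \<cdot>\<^bsub>C\<^esub> h))\<rparr>"

definition is_supremum :: "('o, 'm) star_cat \<Rightarrow> 'o \<Rightarrow> 'm set \<Rightarrow> 'm \<Rightarrow> bool" where
  "is_supremum C A S s \<longleftrightarrow> least (herm_order C A) s (Upper (herm_order C A) S)"

definition bounded_above :: "('o, 'm) star_cat \<Rightarrow> 'o \<Rightarrow> 'm set \<Rightarrow> bool" where
  "bounded_above C A S \<longleftrightarrow> Upper (herm_order C A) S \<noteq> {}"


section \<open>Monotone completeness\<close>

definition directed_set :: "'i set \<Rightarrow> 'i rel \<Rightarrow> bool" where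
  "directed_set J r \<longleftrightarrow> J \<noteq> {} \<and> preorder_on J r \<and>
     (\<forall>i\<in>J. \<forall>j\<in>J. \<exists>k\<in>J. (i, k) \<in> r \<and> (j, k) \<in> r)"

definition increasing_net ::
    "('o, 'm) star_cat \<Rightarrow> 'o \<Rightarrow> 'i set \<Rightarrow> 'i rel \<Rightarrow> ('i \<Rightarrow> 'm) \<Rightarrow> bool" where
  "increasing_net C A J r a \<longleftrightarrow> directed_set J r \<and> (\<forall>j\<in>J. hermitian C A (a j)) \<and>
     (\<forall>(j, k)\<in>r. a j \<sqsubseteq>\<^bsub>herm_order C A\<^esub> a k)"

text \<open>A formula cannot quantify over index types, so the nets range over subsets of the type of
  morphisms. In a pre-Hilbert *-category this loses nothing: an increasing net with any other
  index set has the same bounds and suprema as its image, a directed set of morphisms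
  indexed by itself.\<close>

definition monotone_complete :: "('o, 'm) star_cat \<Rightarrow> bool" where
  "monotone_complete C \<longleftrightarrow>
     (\<forall>A\<in>Ob C. \<forall>(J :: 'm set) r a. increasing_net C A J r a \<longrightarrow> bounded_above C A (a ` J) \<longrightarrow>
        (\<exists>s. is_supremum C A (a ` J) s))"


section \<open>Infinite sums and orthogonal completeness\<close>

definition partial_sums :: "('o, 'm) star_cat \<Rightarrow> 'o \<Rightarrow> 'j set \<Rightarrow> ('j \<Rightarrow> 'm) \<Rightarrow> 'm set" where
  "partial_sums C A J a = {\<Oplus>\<^bsub>End C A\<^esub>j\<in>F. a j | F. finite F \<and> F \<subseteq> J}"

text \<open>\<open>has_order_sum C A J a s\<close> says that \<open>\<Sum>j\<in>J. a j\<close> exists and equals \<open>s\<close>.\<close>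

definition has_order_sum ::
    "('o, 'm) star_cat \<Rightarrow> 'o \<Rightarrow> 'j set \<Rightarrow> ('j \<Rightarrow> 'm) \<Rightarrow> 'm \<Rightarrow> bool" where
  "has_order_sum C A J a s \<longleftrightarrow> is_supremum C A (partial_sums C A J a) s"

definition l2_family ::
    "('o, 'm) star_cat \<Rightarrow> 'o \<Rightarrow> 'o \<Rightarrow> 'j set \<Rightarrow> ('j \<Rightarrow> 'm) \<Rightarrow> bool" where
  "l2_family C A X J x \<longleftrightarrow> (\<forall>j\<in>J. x j \<in> homset C A X) \<and>
     (\<forall>j\<in>J. \<forall>k\<in>J. j \<noteq> k \<longrightarrow> Star C (x j) \<cdot>\<^bsub>C\<^esub> x k = zero_mor C A A) \<and>
     bounded_above C A (partial_sums C A J (\<lambda>j. Star C (x j) \<cdot>\<^bsub>C\<^esub> x j))"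

definition is_order_sum ::
    "('o, 'm) star_cat \<Rightarrow> 'o \<Rightarrow> 'o \<Rightarrow> 'j set \<Rightarrow> ('j \<Rightarrow> 'm) \<Rightarrow> 'm \<Rightarrow> bool" where
  "is_order_sum C A X J x s \<longleftrightarrow> s \<in> homset C A X \<and>
     (\<forall>j\<in>J. Star C s \<cdot>\<^bsub>C\<^esub> x j = Star C (x j) \<cdot>\<^bsub>C\<^esub> x j) \<and>
     has_order_sum C A J (\<lambda>j. Star C (x j) \<cdot>\<^bsub>C\<^esub> x j) (Star C s \<cdot>\<^bsub>C\<^esub> s)"

text \<open>Again the index sets consist of morphisms, without loss of generality: the zero members of an
  \<open>\<ell>\<^sup>2\<close>-family are irrelevant for its order sums, and its nonzero members are pairwise distinct
  (in a pre-Hilbert *-category \<open>x* x = 0\<close> only for \<open>x = 0\<close>), so they can index themselves.\<close>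

definition orthogonally_complete :: "('o, 'm) star_cat \<Rightarrow> bool" where
  "orthogonally_complete C \<longleftrightarrow>
     (\<forall>A\<in>Ob C. \<forall>X\<in>Ob C. \<forall>(J :: 'm set) x. l2_family C A X J x \<longrightarrow>
        (\<exists>s. is_order_sum C A X J x s))"


section \<open>\<open>\<ell>\<^sup>2\<close>-products and \<open>\<ell>\<^sup>2\<close>-biproducts\<close>

definition span ::
    "('o, 'm) star_cat \<Rightarrow> 'j set \<Rightarrow> ('j \<Rightarrow> 'o) \<Rightarrow> 'o \<Rightarrow> ('j \<Rightarrow> 'm) \<Rightarrow> bool" where
  "span C J Xs Y g \<longleftrightarrow> Y \<in> Ob C \<and> (\<forall>j\<in>J. Xs j \<in> Ob C \<and> g j \<in> homset C Y (Xs j))"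

definition l2_span ::
    "('o, 'm) star_cat \<Rightarrow> 'j set \<Rightarrow> ('j \<Rightarrow> 'o) \<Rightarrow> 'o \<Rightarrow> ('j \<Rightarrow> 'm) \<Rightarrow> bool" where
  "l2_span C J Xs Y g \<longleftrightarrow> span C J Xs Y g \<and>
     bounded_above C Y (partial_sums C Y J (\<lambda>j. Star C (g j) \<cdot>\<^bsub>C\<^esub> g j))"

definition l2_product ::
    "('o, 'm) star_cat \<Rightarrow> 'j set \<Rightarrow> ('j \<Rightarrow> 'o) \<Rightarrow> 'o \<Rightarrow> ('j \<Rightarrow> 'm) \<Rightarrow> bool" where
  "l2_product C J Xs X r \<longleftrightarrow> l2_span C J Xs X r \<and>
     (\<forall>Y gs. l2_span C J Xs Y gs \<longrightarrow>
        (\<exists>!g. g \<in> homset C Y X \<and> (\<forall>j\<in>J. r j \<cdot>\<^bsub>C\<^esub> g = gs j)) \<and>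
        (\<forall>g. g \<in> homset C Y X \<and> (\<forall>j\<in>J. r j \<cdot>\<^bsub>C\<^esub> g = gs j) \<longrightarrow>
           has_order_sum C Y J (\<lambda>j. Star C (gs j) \<cdot>\<^bsub>C\<^esub> gs j) (Star C g \<cdot>\<^bsub>C\<^esub> g)))"

definition l2_biproduct ::
    "('o, 'm) star_cat \<Rightarrow> 'j set \<Rightarrow> ('j \<Rightarrow> 'o) \<Rightarrow> 'o \<Rightarrow> ('j \<Rightarrow> 'm) \<Rightarrow> bool" where
  "l2_biproduct C J Xs X r \<longleftrightarrow> span C J Xs X r \<and>
     (\<forall>j\<in>J. \<forall>k\<in>J. r j \<cdot>\<^bsub>C\<^esub> Star C (r k) =
        (if j = k then Ident C (Xs j) else zero_mor C (Xs k) (Xs j))) \<and>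
     has_order_sum C X J (\<lambda>j. Star C (r j) \<cdot>\<^bsub>C\<^esub> r j) (Ident C X)"


section \<open>Independence of the choices of zero object and of orthonormal product\<close>

lemma (in category) homset_Ob:
  assumes "f \<in> homset C X Y"
  shows "X \<in> Ob C" "Y \<in> Ob C"
  using assms Dom_in_Ob[of f] Cod_in_Ob[of f] by (auto simp: homset_def)

lemma (in star_category) Star_Star_homset:
  "f \<in> homset C X Y \<Longrightarrow> Star C (Star C f) = f"
  by (rule Star_Star) (simp add: homset_def)

lemma zero_object_ex:
  assumes "zero_object C Z" "X \<in> Ob C"
  shows "\<exists>f. f \<in> homset C X Z" "\<exists>f. f \<in> homset C Z X"
  using assms by (simp_all add: zero_object_def ex1_implies_ex)

lemma zero_object_unique:
  assumes "zero_object C Z" "X \<in> Ob C"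
  shows "\<lbrakk>f \<in> homset C X Z; g \<in> homset C X Z\<rbrakk> \<Longrightarrow> f = g"
    and "\<lbrakk>f \<in> homset C Z X; g \<in> homset C Z X\<rbrakk> \<Longrightarrow> f = g"
  using assms unfolding zero_object_def by metis+

lemma (in category) zero_mor_eq:
  assumes "zero_object C Z" "u \<in> homset C X Z" "v \<in> homset C Z Y"
  shows "zero_mor C X Y = v \<cdot> u"
  unfolding zero_mor_def
proof (rule the_equality)
  show "\<exists>Z u' v'. zero_object C Z \<and> u' \<in> homset C X Z \<and> v' \<in> homset C Z Y \<and> v \<cdot> u = v' \<cdot> u'"
    using assms by blast
next
  fix f assume "\<exists>Z u v. zero_object C Z \<and> u \<in> homset C X Z \<and> v \<in> homset C Z Y \<and> f = v \<cdot> u"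
  then obtain Z' u' v' where *: "zero_object C Z'" "u' \<in> homset C X Z'" "v' \<in> homset C Z' Y"
    "f = v' \<cdot> u'" by blast
  have ob: "X \<in> Ob C" "Y \<in> Ob C"
    by (rule homset_Ob(1)[OF assms(2)], rule homset_Ob(2)[OF assms(3)])
  obtain w where w: "w \<in> homset C Z Z'"
    using zero_object_ex(1)[OF *(1)] assms(1) unfolding zero_object_def by blast
  have "w \<cdot> u = u'"
    by (rule zero_object_unique(1)[OF *(1) ob(1) Comp_in_homset[OF assms(2) w] *(2)])
  moreover have "v' \<cdot> w = v"
    by (rule zero_object_unique(2)[OF assms(1) ob(2) Comp_in_homset[OF w *(3)] assms(3)])
  ultimately show "f = v \<cdot> u"
    using Comp_assoc[OF assms(2) w *(3)] *(4) by simp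
qed

lemma (in pre_hilbert_star_category) zero_mor_props:
  assumes "X \<in> Ob C" "Y \<in> Ob C"
  shows zero_mor_in_homset: "zero_mor C X Y \<in> homset C X Y"
    and Star_zero_mor: "Star C (zero_mor C X Y) = zero_mor C Y X"
proof -
  obtain Z where Z: "zero_object C Z" using ex_zero_object by blast
  obtain u v where uv: "u \<in> homset C X Z" "v \<in> homset C Z Y"
    using zero_object_ex(1)[OF Z assms(1)] zero_object_ex(2)[OF Z assms(2)] by blast
  note eq = zero_mor_eq[OF Z uv]
  show "zero_mor C X Y \<in> homset C X Y"
    using eq Comp_in_homset[OF uv] by simp
  show "Star C (zero_mor C X Y) = zero_mor C Y X"
    using eq Star_Comp[OF uv] zero_mor_eq[OF Z Star_in_homset[OF uv(2)] Star_in_homset[OF uv(1)]]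
    by simp
qed

lemma (in pre_hilbert_star_category) mor_add_eq:
  assumes P: "orthonormal_product C Y Y P r1 r2"
    and d: "d \<in> homset C Y P" "r1 \<cdot> d = Ident C Y" "r2 \<cdot> d = Ident C Y"
    and u: "u \<in> homset C X P" "r1 \<cdot> u = f" "r2 \<cdot> u = g"
    and f: "f \<in> homset C X Y"
  shows "mor_add C f g = Star C d \<cdot> u"
proof -
  have [simp]: "Cod C f = Y" "Dom C f = X" using f by (auto simp: homset_def)
  have Y: "Y \<in> Ob C" by (rule homset_Ob(2)[OF f])
  have X: "X \<in> Ob C" by (rule homset_Ob(1)[OF f])
  show ?thesis
    unfolding mor_add_def
  proof (rule the_equality, goal_cases)
    case 1
    show ?case
      by (rule exI[of _ P], rule exI[of _ r1], rule exI[of _ r2], rule exI[of _ d], rule exI[of _ u])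
        (simp add: P d u)
  next
    case (2 h)
    then obtain Q s1 s2 e w where Q: "orthonormal_product C Y Y Q s1 s2"
      and e: "e \<in> homset C Y Q" "s1 \<cdot> e = Ident C Y" "s2 \<cdot> e = Ident C Y"
      and w: "w \<in> homset C X Q" "s1 \<cdot> w = f" "s2 \<cdot> w = g" and h: "h = Star C e \<cdot> w"
      by (elim exE conjE) simp
    have r: "r1 \<in> homset C P Y" "r2 \<in> homset C P Y"
      and s: "s1 \<in> homset C Q Y" "s2 \<in> homset C Q Y"
      using P Q by (auto simp: orthonormal_product_def binary_product_def)
    have obs: "P \<in> Ob C" "Q \<in> Ob C" by (rule homset_Ob(1)[OF r(1)], rule homset_Ob(1)[OF s(1)])
    have uniP: "a = b" if "a \<in> homset C W P" "b \<in> homset C W P" "r1 \<cdot> a = r1 \<cdot> b"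
        "r2 \<cdot> a = r2 \<cdot> b" for a b W
    proof -
      have "W \<in> Ob C" using homset_Ob(1)[OF that(1)] .
      moreover have "r1 \<cdot> b \<in> homset C W Y" "r2 \<cdot> b \<in> homset C W Y"
        by (rule Comp_in_homset[OF that(2) r(1)], rule Comp_in_homset[OF that(2) r(2)])
      ultimately have "\<exists>!g. g \<in> homset C W P \<and> r1 \<cdot> g = r1 \<cdot> b \<and> r2 \<cdot> g = r2 \<cdot> b"
        using P unfolding orthonormal_product_def binary_product_def by blast
      then show ?thesis using that by blast
    qed
    obtain p where p: "p \<in> homset C Q P" "r1 \<cdot> p = s1" "r2 \<cdot> p = s2"
      using P obs s unfolding orthonormal_product_def binary_product_def by blast
    have rr: "r1 \<cdot> Star C r1 = Ident C Y" "r2 \<cdot> Star C r2 = Ident C Y"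
        "r1 \<cdot> Star C r2 = zero_mor C Y Y"
      using P r unfolding orthonormal_product_def coisometry_def by (auto simp: homset_def)
    have ss: "s1 \<cdot> Star C s1 = Ident C Y" "s2 \<cdot> Star C s2 = Ident C Y"
        "s1 \<cdot> Star C s2 = zero_mor C Y Y"
      using Q s unfolding orthonormal_product_def coisometry_def by (auto simp: homset_def)
    have rr': "r2 \<cdot> Star C r1 = zero_mor C Y Y"
      using rr(3) Star_Comp[OF Star_in_homset[OF r(2)] r(1)] Star_zero_mor[OF Y Y]
      by (simp add: Star_Star_homset[OF r(1)] Star_Star_homset[OF r(2)])
    have ss': "s2 \<cdot> Star C s1 = zero_mor C Y Y"
      using ss(3) Star_Comp[OF Star_in_homset[OF s(2)] s(1)] Star_zero_mor[OF Y Y]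
      by (simp add: Star_Star_homset[OF s(1)] Star_Star_homset[OF s(2)])
    note stars = Star_in_homset[OF s(1)] Star_in_homset[OF s(2)] Star_in_homset[OF p(1)]
      Star_in_homset[OF r(1)] Star_in_homset[OF r(2)]
    have "p \<cdot> Star C s1 = Star C r1"
      by (rule uniP[OF Comp_in_homset[OF stars(1) p(1)] stars(4)])
        (simp_all add: Comp_assoc[OF stars(1) p(1) r(1), symmetric]
           Comp_assoc[OF stars(1) p(1) r(2), symmetric] p rr rr' ss ss')
    then have s1: "s1 \<cdot> Star C p = r1"
      using Star_Comp[OF stars(1) p(1)]
      by (simp add: Star_Star_homset[OF s(1)] Star_Star_homset[OF r(1)])
    have "p \<cdot> Star C s2 = Star C r2"
      by (rule uniP[OF Comp_in_homset[OF stars(2) p(1)] stars(5)])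
        (simp_all add: Comp_assoc[OF stars(2) p(1) r(1), symmetric]
           Comp_assoc[OF stars(2) p(1) r(2), symmetric] p rr rr' ss ss')
    then have s2: "s2 \<cdot> Star C p = r2"
      using Star_Comp[OF stars(2) p(1)]
      by (simp add: Star_Star_homset[OF s(2)] Star_Star_homset[OF r(2)])
    have pp: "p \<cdot> Star C p = Ident C P"
      by (rule uniP[OF Comp_in_homset[OF stars(3) p(1)] Ident_in_homset[OF obs(1)]])
        (simp_all add: Comp_assoc[OF stars(3) p(1) r(1), symmetric]
           Comp_assoc[OF stars(3) p(1) r(2), symmetric] p s1 s2 Comp_Ident[OF r(1)] Comp_Ident[OF r(2)])
    have uniQ: "a = b" if "a \<in> homset C W Q" "b \<in> homset C W Q" "s1 \<cdot> a = s1 \<cdot> b"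
        "s2 \<cdot> a = s2 \<cdot> b" for a b W
    proof -
      have "W \<in> Ob C" using homset_Ob(1)[OF that(1)] .
      moreover have "s1 \<cdot> b \<in> homset C W Y" "s2 \<cdot> b \<in> homset C W Y"
        by (rule Comp_in_homset[OF that(2) s(1)], rule Comp_in_homset[OF that(2) s(2)])
      ultimately have "\<exists>!g. g \<in> homset C W Q \<and> s1 \<cdot> g = s1 \<cdot> b \<and> s2 \<cdot> g = s2 \<cdot> b"
        using Q unfolding orthonormal_product_def binary_product_def by blast
      then show ?thesis using that by blast
    qed
    have we: "w = Star C p \<cdot> u"
      by (rule uniQ[OF w(1) Comp_in_homset[OF u(1) stars(3)]])
        (simp_all add: Comp_assoc[OF u(1) stars(3) s(1), symmetric]
           Comp_assoc[OF u(1) stars(3) s(2), symmetric] s1 s2 u w)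
    have ee: "e = Star C p \<cdot> d"
      by (rule uniQ[OF e(1) Comp_in_homset[OF d(1) stars(3)]])
        (simp_all add: Comp_assoc[OF d(1) stars(3) s(1), symmetric]
           Comp_assoc[OF d(1) stars(3) s(2), symmetric] s1 s2 d e)
    have "Star C e = Star C d \<cdot> p"
      using Star_Comp[OF d(1) stars(3)] by (simp add: ee Star_Star_homset[OF p(1)])
    then have "h = (Star C d \<cdot> p) \<cdot> (Star C p \<cdot> u)" using h we by simp
    also have "\<dots> = Star C d \<cdot> (p \<cdot> (Star C p \<cdot> u))"
      by (rule Comp_assoc[OF Comp_in_homset[OF u(1) stars(3)] p(1) Star_in_homset[OF d(1)]])
    also have "p \<cdot> (Star C p \<cdot> u) = u"
      by (simp add: Comp_assoc[OF u(1) stars(3) p(1), symmetric] pp Ident_Comp[OF u(1)])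
    finally show ?case .
  qed
qed

end

theory Submission
  imports Defs
begin

text \<open>
  The elementary facts behind the theorem are these. If \<open>z* z = 0\<close>, then \<open>z\<close> factors through an
  isometric kernel of \<open>z*\<close> and so vanishes; orthonormal products are biproducts, which makes
  every hom-set a commutative monoid with bilinear composition; and the fact that diagonals are
  kernels supplies negatives. Sums of positive elements are positive because
  \<open>h* h + k* k = u* u\<close> for the pairing \<open>u\<close> of \<open>h\<close> and \<open>k\<close>, and \<open>h* h + k* k = 0\<close> forces
  \<open>h = 0\<close>.

  Let \<open>(r\<^sub>j : X \<rightarrow> X\<^sub>j)\<close> be an \<open>\<ell>\<^sup>2\<close>-biproduct and \<open>(g\<^sub>j : Y \<rightarrow> X\<^sub>j)\<close> an
  \<open>\<ell>\<^sup>2\<close>-span. The morphisms \<open>x\<^sub>j = r\<^sub>j* g\<^sub>j\<close> form an \<open>\<ell>\<^sup>2\<close>-family with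
  \<open>x\<^sub>j* x\<^sub>j = g\<^sub>j* g\<^sub>j\<close>, so they have an order sum \<open>s\<close>; in particular
  \<open>s* s = \<Sum>j. g\<^sub>j* g\<^sub>j\<close>.

  To see that \<open>r\<^sub>j s = g\<^sub>j\<close>, put \<open>w = r\<^sub>j s - g\<^sub>j\<close>. For finite \<open>F\<close> containing \<open>j\<close>,
  the remainder \<open>y = s - \<Sum>k\<in>F. x\<^sub>k\<close> has \<open>y* y = s* s - \<Sum>k\<in>F. g\<^sub>k* g\<^sub>k\<close> and
  \<open>r\<^sub>j y = w\<close>, hence \<open>y* y \<ge> w* w\<close>. So \<open>s* s - w* w\<close> bounds all partial sums of
  \<open>\<Sum>k. g\<^sub>k* g\<^sub>k\<close>; as \<open>s* s\<close> is their least upper bound, \<open>w = 0\<close>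
  (\<open>order_sum_components\<close>).

  Uniqueness amounts to the joint faithfulness of the \<open>r\<^sub>j\<close>
  (\<open>l2_biproduct_jointly_faithful\<close>): if \<open>r\<^sub>j h = 0\<close> for all \<open>j\<close>, the projection \<open>p\<close> onto the
  kernel of \<open>h*\<close> is an upper bound of the partial sums of \<open>\<Sum>j. r\<^sub>j* r\<^sub>j = 1\<close>, so that
  \<open>1 \<le> p\<close> and \<open>h = 0\<close>.
\<close>

section \<open>Composition and adjoints\<close>

text \<open>Membership in hom-sets is expressed by equations for domains and codomains, so that the
  simplifier can check composability.\<close>

context category begin

lemma Comp_typing [simp]:
  assumes "f \<in> Mor C" "g \<in> Mor C" "Dom C g = Cod C f"
  shows "g \<cdot> f \<in> Mor C" "Dom C (g \<cdot> f) = Dom C f" "Cod C (g \<cdot> f) = Cod C g"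
  using Comp_in_homset[of f "Dom C f" "Cod C f" g "Cod C g"] assms by (auto simp: homset_def)

lemma Ident_typing [simp]:
  assumes "X \<in> Ob C"
  shows "Ident C X \<in> Mor C" "Dom C (Ident C X) = X" "Cod C (Ident C X) = X"
  using Ident_in_homset[OF assms] by (auto simp: homset_def)

lemma Comp_rules [simp]:
  "\<lbrakk>f \<in> Mor C; Dom C f = X\<rbrakk> \<Longrightarrow> f \<cdot> Ident C X = f"
  "\<lbrakk>f \<in> Mor C; Cod C f = X\<rbrakk> \<Longrightarrow> Ident C X \<cdot> f = f"
  "\<lbrakk>f \<in> Mor C; g \<in> Mor C; h \<in> Mor C; Dom C g = Cod C f; Dom C h = Cod C g\<rbrakk>
    \<Longrightarrow> (h \<cdot> g) \<cdot> f = h \<cdot> (g \<cdot> f)"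
  using Comp_Ident[of f "Dom C f" "Cod C f"] Ident_Comp[of f "Dom C f" "Cod C f"]
    Comp_assoc[of f "Dom C f" "Cod C f" g "Cod C g" h "Cod C h"]
  by (auto simp: homset_def)

declare Dom_in_Ob [simp] Cod_in_Ob [simp]

text \<open>Composition is normalised to the right, so an equation \<open>a \<cdot> b = c\<close> also has to be usable
  in front of a further factor.\<close>

lemma Comp_reduce:
  "\<lbrakk>a \<cdot> b = c; a \<in> Mor C; b \<in> Mor C; h \<in> Mor C; Dom C a = Cod C b; Dom C b = Cod C h\<rbrakk>
    \<Longrightarrow> a \<cdot> (b \<cdot> h) = c \<cdot> h"
  using Comp_rules(3)[of h b a] by simp

end

context star_category begin

lemma Star_typing [simp]:
  assumes "f \<in> Mor C"
  shows "Star C f \<in> Mor C" "Dom C (Star C f) = Cod C f" "Cod C (Star C f) = Dom C f"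
  using Star_in_homset[of f "Dom C f" "Cod C f"] assms by (auto simp: homset_def)

lemma Star_rules [simp]:
  "\<lbrakk>f \<in> Mor C; g \<in> Mor C; Dom C g = Cod C f\<rbrakk> \<Longrightarrow> Star C (g \<cdot> f) = Star C f \<cdot> Star C g"
  using Star_Comp[of f "Dom C f" "Cod C f" g "Cod C g"] by (simp add: homset_def)

declare Star_Ident [simp] Star_Star [simp]

lemma Star_Comp_eq:
  "\<lbrakk>g \<cdot> f = h; f \<in> Mor C; g \<in> Mor C; Dom C g = Cod C f\<rbrakk> \<Longrightarrow> Star C f \<cdot> Star C g = Star C h"
  using Star_rules[of f g] by simp

lemma Star_inject: "\<lbrakk>f \<in> Mor C; g \<in> Mor C; Star C f = Star C g\<rbrakk> \<Longrightarrow> f = g"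
  using Star_Star by metis

end

context pre_hilbert_star_category begin

lemma zero_typing [simp]:
  assumes "X \<in> Ob C" "Y \<in> Ob C"
  shows "zero_mor C X Y \<in> Mor C" "Dom C (zero_mor C X Y) = X" "Cod C (zero_mor C X Y) = Y"
  using zero_mor_in_homset[OF assms] by (auto simp: homset_def)

declare Star_zero_mor [simp]

lemma zero_Comp [simp]:
  assumes "f \<in> Mor C" "Cod C f = Y" "Z \<in> Ob C"
  shows "zero_mor C Y Z \<cdot> f = zero_mor C (Dom C f) Z"
proof -
  have X: "Dom C f \<in> Ob C" and Y: "Y \<in> Ob C" using assms by auto
  obtain O' where O': "zero_object C O'" using ex_zero_object by blast
  obtain u v where uv: "u \<in> homset C Y O'" "v \<in> homset C O' Z"
    using zero_object_ex(1)[OF O' Y] zero_object_ex(2)[OF O' assms(3)] by blast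
  have f: "f \<in> homset C (Dom C f) Y" using assms by (simp add: homset_def)
  show ?thesis
    using zero_mor_eq[OF O' uv] zero_mor_eq[OF O' Comp_in_homset[OF f uv(1)] uv(2)]
      Comp_assoc[OF f uv] by simp
qed

lemma Comp_zero [simp]:
  assumes "f \<in> Mor C" "Dom C f = Y" "X \<in> Ob C"
  shows "f \<cdot> zero_mor C X Y = zero_mor C X (Cod C f)"
proof -
  have "Y \<in> Ob C" using assms by auto
  then have eq: "Star C (f \<cdot> zero_mor C X Y) = Star C (zero_mor C X (Cod C f))"
    using assms by simp
  show ?thesis
    by (rule Star_inject[OF _ _ eq]) (use assms \<open>Y \<in> Ob C\<close> in auto)
qed

text \<open>The factorisation of \<open>g\<close> through an isometric kernel \<open>k\<close> is \<open>g = k (k* g)\<close>.\<close>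

lemma isometric_kernel:
  assumes f: "f \<in> Mor C" "Dom C f = X" "Cod C f = Y"
  obtains k where "k \<in> Mor C" "Cod C k = X" "f \<cdot> k = zero_mor C (Dom C k) Y"
    "Star C k \<cdot> k = Ident C (Dom C k)"
    "\<And>g. \<lbrakk>g \<in> Mor C; Cod C g = X; f \<cdot> g = zero_mor C (Dom C g) Y\<rbrakk> \<Longrightarrow> k \<cdot> (Star C k \<cdot> g) = g"
proof -
  obtain k where k: "kernel_of C f k" "isometry C k"
    using ex_isometric_kernel[OF f(1)] by blast
  have k': "k \<in> Mor C" "Cod C k = X" "f \<cdot> k = zero_mor C (Dom C k) Y"
    "Star C k \<cdot> k = Ident C (Dom C k)"
    using k f unfolding kernel_of_def isometry_def by blast+
  have "k \<cdot> (Star C k \<cdot> g) = g"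
    if g: "g \<in> Mor C" "Cod C g = X" "f \<cdot> g = zero_mor C (Dom C g) Y" for g
  proof -
    have "Dom C g \<in> Ob C" "g \<in> homset C (Dom C g) (Dom C f)" using g f by (auto simp: homset_def)
    then obtain h where h: "h \<in> homset C (Dom C g) (Dom C k)" "k \<cdot> h = g"
      using k(1) g(3) f(3) unfolding kernel_of_def by blast
    then have "Star C k \<cdot> g = h"
      using k' Comp_reduce[OF k'(4), of h] by (auto simp: homset_def)
    then show ?thesis using h by simp
  qed
  then show thesis using that k' by blast
qed

text \<open>The key to positivity: if \<open>z* z = 0\<close>, then \<open>z\<close> factors through the isometric kernel \<open>k\<close> of
  \<open>z*\<close>, so that \<open>z = k k* z = k (z* k)* = 0\<close>.\<close>

lemma Star_Comp_self_eq_zeroD: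
  assumes z: "z \<in> Mor C" and 0: "Star C z \<cdot> z = zero_mor C (Dom C z) (Dom C z)"
  shows "z = zero_mor C (Dom C z) (Cod C z)"
proof -
  obtain k where k: "k \<in> Mor C" "Cod C k = Cod C z"
      "Star C z \<cdot> k = zero_mor C (Dom C k) (Dom C z)"
    and *: "\<And>g. \<lbrakk>g \<in> Mor C; Cod C g = Cod C z; Star C z \<cdot> g = zero_mor C (Dom C g) (Dom C z)\<rbrakk>
       \<Longrightarrow> k \<cdot> (Star C k \<cdot> g) = g"
    by (rule isometric_kernel[of "Star C z" "Cod C z" "Dom C z"]) (use z in auto)
  have "Star C (Star C z \<cdot> k) = Star C k \<cdot> z" using z k(1,2) by simp
  then have "Star C k \<cdot> z = zero_mor C (Dom C z) (Dom C k)" using z k by simp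
  then show ?thesis using *[OF z] 0 z k by simp
qed

section \<open>Orthonormal products\<close>

lemma orthonormal_productD:
  assumes "orthonormal_product C Y1 Y2 P r1 r2"
  shows "r1 \<in> Mor C" "r2 \<in> Mor C" "Dom C r1 = P" "Dom C r2 = P" "Cod C r1 = Y1" "Cod C r2 = Y2"
    "r1 \<cdot> Star C r1 = Ident C Y1" "r2 \<cdot> Star C r2 = Ident C Y2"
    "r1 \<cdot> Star C r2 = zero_mor C Y2 Y1" "r2 \<cdot> Star C r1 = zero_mor C Y1 Y2"
proof -
  show *: "r1 \<in> Mor C" "r2 \<in> Mor C" "Dom C r1 = P" "Dom C r2 = P" "Cod C r1 = Y1" "Cod C r2 = Y2"
    "r1 \<cdot> Star C r1 = Ident C Y1" "r2 \<cdot> Star C r2 = Ident C Y2"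
    and 0: "r1 \<cdot> Star C r2 = zero_mor C Y2 Y1"
    using assms by (auto simp: orthonormal_product_def binary_product_def coisometry_def homset_def)
  have Y: "Y1 \<in> Ob C" "Y2 \<in> Ob C" using * by auto
  have "Star C (r1 \<cdot> Star C r2) = r2 \<cdot> Star C r1" using * by simp
  then show "r2 \<cdot> Star C r1 = zero_mor C Y1 Y2" using 0 Y by simp
qed

lemma orthonormal_product_pair:
  assumes "orthonormal_product C Y1 Y2 P r1 r2"
    and "f \<in> Mor C" "g \<in> Mor C" "Dom C f = X" "Dom C g = X" "Cod C f = Y1" "Cod C g = Y2"
  obtains u where "u \<in> Mor C" "Dom C u = X" "Cod C u = P" "r1 \<cdot> u = f" "r2 \<cdot> u = g"
proof -
  have "X \<in> Ob C" "f \<in> homset C X Y1" "g \<in> homset C X Y2" using assms by (auto simp: homset_def)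
  then have "\<exists>!u. u \<in> homset C X P \<and> r1 \<cdot> u = f \<and> r2 \<cdot> u = g"
    using assms(1) unfolding orthonormal_product_def binary_product_def by blast
  then show thesis using that unfolding homset_def by blast
qed

lemma orthonormal_product_eqI:
  assumes P: "orthonormal_product C Y1 Y2 P r1 r2"
    and u: "u \<in> Mor C" "v \<in> Mor C" "Cod C u = P" "Cod C v = P" "Dom C u = Dom C v"
    and eq: "r1 \<cdot> u = r1 \<cdot> v" "r2 \<cdot> u = r2 \<cdot> v"
  shows "u = v"
proof -
  note r = orthonormal_productD[OF P]
  have "Dom C v \<in> Ob C" "r1 \<cdot> v \<in> homset C (Dom C v) Y1" "r2 \<cdot> v \<in> homset C (Dom C v) Y2"
    using u r by (auto simp: homset_def)
  then have "\<exists>!w. w \<in> homset C (Dom C v) P \<and> r1 \<cdot> w = r1 \<cdot> v \<and> r2 \<cdot> w = r2 \<cdot> v"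
    using P unfolding orthonormal_product_def binary_product_def by blast
  then show ?thesis using u eq unfolding homset_def by blast
qed

section \<open>Addition of morphisms\<close>

text \<open>Infix notation for the addition of parallel morphisms.\<close>

abbreviation madd (infixl "\<boxplus>" 65) where "f \<boxplus> g \<equiv> mor_add C f g"

lemma addition_data:
  assumes "Y \<in> Ob C"
  obtains P r1 r2 d where "orthonormal_product C Y Y P r1 r2"
    "d \<in> Mor C" "Dom C d = Y" "Cod C d = P" "r1 \<cdot> d = Ident C Y" "r2 \<cdot> d = Ident C Y"
proof -
  obtain P r1 r2 where P: "orthonormal_product C Y Y P r1 r2"
    using ex_orthonormal_product[OF assms assms] by blast
  show thesis
    by (rule orthonormal_product_pair[OF P, of "Ident C Y" "Ident C Y" Y]) (use assms P that in auto)
qed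

lemma mor_add_eq':
  assumes "orthonormal_product C Y Y P r1 r2"
    and "d \<in> Mor C" "Dom C d = Y" "Cod C d = P" "r1 \<cdot> d = Ident C Y" "r2 \<cdot> d = Ident C Y"
    and "u \<in> Mor C" "Cod C u = P"
  shows "(r1 \<cdot> u) \<boxplus> (r2 \<cdot> u) = Star C d \<cdot> u"
  using assms orthonormal_productD[OF assms(1)]
  by (intro mor_add_eq[where X = "Dom C u" and Y = Y and P = P]) (auto simp: homset_def)

lemma add_typing [simp]:
  assumes "f \<in> Mor C" "g \<in> Mor C" "Dom C f = Dom C g" "Cod C f = Cod C g"
  shows "f \<boxplus> g \<in> Mor C" "Dom C (f \<boxplus> g) = Dom C g" "Cod C (f \<boxplus> g) = Cod C g"
proof -
  obtain P r1 r2 d where P: "orthonormal_product C (Cod C g) (Cod C g) P r1 r2"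
    "d \<in> Mor C" "Dom C d = Cod C g" "Cod C d = P"
    "r1 \<cdot> d = Ident C (Cod C g)" "r2 \<cdot> d = Ident C (Cod C g)"
    by (rule addition_data[OF Cod_in_Ob[OF assms(2)]])
  obtain u where u: "u \<in> Mor C" "Dom C u = Dom C g" "Cod C u = P" "r1 \<cdot> u = f" "r2 \<cdot> u = g"
    using orthonormal_product_pair[OF P(1), of f g] assms by auto
  show "f \<boxplus> g \<in> Mor C" "Dom C (f \<boxplus> g) = Dom C g" "Cod C (f \<boxplus> g) = Cod C g"
    using mor_add_eq'[OF P, of u] u P by auto
qed

lemma add_Comp:
  assumes "f \<in> Mor C" "g \<in> Mor C" "h \<in> Mor C" "Dom C f = Cod C h" "Dom C g = Cod C h"
    "Cod C f = Cod C g"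
  shows "(f \<boxplus> g) \<cdot> h = f \<cdot> h \<boxplus> g \<cdot> h"
proof -
  obtain P r1 r2 d where P: "orthonormal_product C (Cod C g) (Cod C g) P r1 r2"
    "d \<in> Mor C" "Dom C d = Cod C g" "Cod C d = P"
    "r1 \<cdot> d = Ident C (Cod C g)" "r2 \<cdot> d = Ident C (Cod C g)"
    by (rule addition_data[OF Cod_in_Ob[OF assms(2)]])
  note r = orthonormal_productD[OF P(1)]
  obtain u where u: "u \<in> Mor C" "Dom C u = Dom C g" "Cod C u = P" "r1 \<cdot> u = f" "r2 \<cdot> u = g"
    using orthonormal_product_pair[OF P(1), of f g] assms by auto
  have "r1 \<cdot> (u \<cdot> h) = f \<cdot> h" "r2 \<cdot> (u \<cdot> h) = g \<cdot> h"
    using u assms r by (auto intro!: Comp_reduce)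
  then show ?thesis
    using mor_add_eq'[OF P, of u] mor_add_eq'[OF P, of "u \<cdot> h"] u assms P by simp
qed

text \<open>For \<open>k : Y \<rightarrow> Z\<close>, both composites \<open>Y \<oplus> Y \<rightarrow> Z\<close> in \<open>k \<nabla> = \<nabla> (k \<oplus> k)\<close> are compared
  through their adjoints, whose components can be computed.\<close>

lemma Comp_add:
  assumes "f \<in> Mor C" "g \<in> Mor C" "k \<in> Mor C" "Dom C f = Dom C g" "Cod C f = Dom C k"
    "Cod C g = Dom C k"
  shows "k \<cdot> (f \<boxplus> g) = k \<cdot> f \<boxplus> k \<cdot> g"
proof -
  define Y Z where "Y = Dom C k" and "Z = Cod C k"
  have k: "Dom C k = Y" "Cod C k = Z" "Y \<in> Ob C" "Z \<in> Ob C" using assms by (auto simp: Y_def Z_def)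
  obtain P r1 r2 d where P: "orthonormal_product C Y Y P r1 r2"
    "d \<in> Mor C" "Dom C d = Y" "Cod C d = P" "r1 \<cdot> d = Ident C Y" "r2 \<cdot> d = Ident C Y"
    by (rule addition_data[OF k(3)])
  obtain Q s1 s2 e where Q: "orthonormal_product C Z Z Q s1 s2"
    "e \<in> Mor C" "Dom C e = Z" "Cod C e = Q" "s1 \<cdot> e = Ident C Z" "s2 \<cdot> e = Ident C Z"
    by (rule addition_data[OF k(4)])
  note r = orthonormal_productD[OF P(1)] and s = orthonormal_productD[OF Q(1)]
  obtain u where u: "u \<in> Mor C" "Dom C u = Dom C g" "Cod C u = P" "r1 \<cdot> u = f" "r2 \<cdot> u = g"
    using orthonormal_product_pair[OF P(1), of f g] assms k by auto
  obtain kk where kk: "kk \<in> Mor C" "Dom C kk = P" "Cod C kk = Q" "s1 \<cdot> kk = k \<cdot> r1" "s2 \<cdot> kk = k \<cdot> r2"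
    using orthonormal_product_pair[OF Q(1), of "k \<cdot> r1" "k \<cdot> r2"] assms k r by auto
  have POb: "P \<in> Ob C" "Q \<in> Ob C" using r s by auto
  have 1: "kk \<cdot> Star C r1 = Star C s1 \<cdot> k" 
    by (rule orthonormal_product_eqI[OF Q(1)])
      (use r s kk k assms POb in \<open>simp_all add: Comp_reduce[OF kk(4)] Comp_reduce[OF kk(5)] 
        Comp_reduce[OF s(7)] Comp_reduce[OF s(10)]\<close>)
  have 2: "kk \<cdot> Star C r2 = Star C s2 \<cdot> k"
    by (rule orthonormal_product_eqI[OF Q(1)])
      (use r s kk k assms POb in \<open>simp_all add: Comp_reduce[OF kk(4)] Comp_reduce[OF kk(5)] 
        Comp_reduce[OF s(8)] Comp_reduce[OF s(9)]\<close>)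
  have c1: "r1 \<cdot> Star C kk = Star C k \<cdot> s1" 
    using arg_cong[OF 1, of "Star C"] kk r s k assms by simp
  have c2: "r2 \<cdot> Star C kk = Star C k \<cdot> s2" 
    using arg_cong[OF 2, of "Star C"] kk r s k assms by simp
  have "d \<cdot> Star C k = Star C kk \<cdot> e"
    by (rule orthonormal_product_eqI[OF P(1)])
      (use r s kk k assms POb P Q in \<open>simp_all add: Comp_reduce[OF P(5)] Comp_reduce[OF P(6)] 
        Comp_reduce[OF c1] Comp_reduce[OF c2]\<close>)
  from arg_cong[OF this, of "Star C"] have "k \<cdot> Star C d = Star C e \<cdot> kk"
    using assms k P Q kk by simp
  then have *: "k \<cdot> (Star C d \<cdot> u) = Star C e \<cdot> (kk \<cdot> u)"
    using assms k P Q kk u by (subst Comp_reduce) auto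
  have "s1 \<cdot> (kk \<cdot> u) = k \<cdot> f" "s2 \<cdot> (kk \<cdot> u) = k \<cdot> g"
    using Comp_reduce[OF kk(4), of u] Comp_reduce[OF kk(5), of u] u kk s r k assms by auto
  then show ?thesis
    using * mor_add_eq'[OF P, of u] mor_add_eq'[OF Q, of "kk \<cdot> u"] u kk by simp
qed


lemma add_zero [simp]:
  assumes f: "f \<in> Mor C" "Dom C f = X" "Cod C f = Y"
  shows "f \<boxplus> zero_mor C X Y = f" and "zero_mor C X Y \<boxplus> f = f"
proof -
  have ob: "X \<in> Ob C" "Y \<in> Ob C" using f by auto
  obtain P r1 r2 d where P: "orthonormal_product C Y Y P r1 r2"
    "d \<in> Mor C" "Dom C d = Y" "Cod C d = P" "r1 \<cdot> d = Ident C Y" "r2 \<cdot> d = Ident C Y"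
    by (rule addition_data[OF ob(2)])
  note r = orthonormal_productD[OF P(1)]
  have d: "Star C d \<cdot> Star C r1 = Ident C Y" "Star C d \<cdot> Star C r2 = Ident C Y"
    using Star_Comp_eq[OF P(5)] Star_Comp_eq[OF P(6)] P r ob by simp_all
  show "f \<boxplus> zero_mor C X Y = f"
    using mor_add_eq'[OF P, of "Star C r1 \<cdot> f"] Comp_reduce[OF r(7), of f] Comp_reduce[OF r(10), of f]
      Comp_reduce[OF d(1), of f] f r P ob by simp
  show "zero_mor C X Y \<boxplus> f = f"
    using mor_add_eq'[OF P, of "Star C r2 \<cdot> f"] Comp_reduce[OF r(8), of f] Comp_reduce[OF r(9), of f]
      Comp_reduce[OF d(2), of f] f r P ob by simp
qed

text \<open>Addition is a morphism \<open>d* : Y \<oplus> Y \<rightarrow> Y\<close>, and composition with a morphism is additive. This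
  is the interchange law, from which commutativity and associativity follow by the
  Eckmann-Hilton argument.\<close>

lemma add_interchange:
  assumes f: "f1 \<in> Mor C" "f2 \<in> Mor C" "g1 \<in> Mor C" "g2 \<in> Mor C"
    and D: "Dom C f1 = X" "Dom C f2 = X" "Dom C g1 = X" "Dom C g2 = X"
    and Y: "Cod C f1 = Y" "Cod C f2 = Y" "Cod C g1 = Y" "Cod C g2 = Y"
  shows "(f1 \<boxplus> f2) \<boxplus> (g1 \<boxplus> g2) = (f1 \<boxplus> g1) \<boxplus> (f2 \<boxplus> g2)"
proof -
  have Yob: "Y \<in> Ob C" using f Y by auto
  obtain P r1 r2 d where P: "orthonormal_product C Y Y P r1 r2"
    "d \<in> Mor C" "Dom C d = Y" "Cod C d = P" "r1 \<cdot> d = Ident C Y" "r2 \<cdot> d = Ident C Y"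
    by (rule addition_data[OF Yob])
  note r = orthonormal_productD[OF P(1)]
  obtain u where u: "u \<in> Mor C" "Dom C u = X" "Cod C u = P" "r1 \<cdot> u = f1" "r2 \<cdot> u = g1"
    by (rule orthonormal_product_pair[OF P(1), of f1 g1]) (use f D Y in auto)
  obtain v where v: "v \<in> Mor C" "Dom C v = X" "Cod C v = P" "r1 \<cdot> v = f2" "r2 \<cdot> v = g2"
    by (rule orthonormal_product_pair[OF P(1), of f2 g2]) (use f D Y in auto)
  \<comment> \<open>\<open>u + v\<close> has the components \<open>f1 + f2\<close> and \<open>g1 + g2\<close>.\<close>
  have "(f1 \<boxplus> f2) \<boxplus> (g1 \<boxplus> g2) = Star C d \<cdot> (u \<boxplus> v)"
    using mor_add_eq'[OF P, of "u \<boxplus> v"] u v r by (simp add: Comp_add)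
  also have "\<dots> = Star C d \<cdot> u \<boxplus> Star C d \<cdot> v" using u v P by (simp add: Comp_add)
  also have "\<dots> = (f1 \<boxplus> g1) \<boxplus> (f2 \<boxplus> g2)"
    using mor_add_eq'[OF P, of u] mor_add_eq'[OF P, of v] u v by simp
  finally show ?thesis .
qed

lemma add_commute:
  assumes "f \<in> Mor C" "g \<in> Mor C" "Dom C f = Dom C g" "Cod C f = Cod C g"
  shows "f \<boxplus> g = g \<boxplus> f"
  using add_interchange[of "zero_mor C (Dom C g) (Cod C g)" f g "zero_mor C (Dom C g) (Cod C g)"
    "Dom C g" "Cod C g"] assms
  by simp

lemma add_assoc:
  assumes "f \<in> Mor C" "g \<in> Mor C" "h \<in> Mor C" "Dom C f = Dom C h" "Dom C g = Dom C h"
    "Cod C f = Cod C h" "Cod C g = Cod C h"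
  shows "(f \<boxplus> g) \<boxplus> h = f \<boxplus> (g \<boxplus> h)"
  using add_interchange[of f g "zero_mor C (Dom C h) (Cod C h)" h "Dom C h" "Cod C h"] assms by simp

text \<open>An orthonormal product is a biproduct with injections \<open>r\<^sub>1*\<close> and \<open>r\<^sub>2*\<close>.\<close>

lemma orthonormal_resolution:
  assumes "orthonormal_product C Y1 Y2 P r1 r2"
  shows "Star C r1 \<cdot> r1 \<boxplus> Star C r2 \<cdot> r2 = Ident C P"
proof -
  note r = orthonormal_productD[OF assms]
  have ob: "P \<in> Ob C" "Y1 \<in> Ob C" "Y2 \<in> Ob C" using r by auto
  show ?thesis
    by (rule orthonormal_product_eqI[OF assms])
      (use r ob in \<open>simp_all add: Comp_add Comp_reduce[OF r(7)] Comp_reduce[OF r(8)]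
        Comp_reduce[OF r(9)] Comp_reduce[OF r(10)]\<close>)
qed

lemma Star_add [simp]:
  assumes f: "f \<in> Mor C" "g \<in> Mor C" "Dom C f = Dom C g" "Cod C f = Cod C g"
  shows "Star C (f \<boxplus> g) = Star C f \<boxplus> Star C g"
proof -
  define Y where "Y = Cod C g"
  have Y: "Cod C f = Y" "Cod C g = Y" "Y \<in> Ob C" using f by (auto simp: Y_def)
  obtain P r1 r2 d where P: "orthonormal_product C Y Y P r1 r2"
    "d \<in> Mor C" "Dom C d = Y" "Cod C d = P" "r1 \<cdot> d = Ident C Y" "r2 \<cdot> d = Ident C Y"
    by (rule addition_data[OF Y(3)])
  note r = orthonormal_productD[OF P(1)]
  obtain u where u: "u \<in> Mor C" "Dom C u = Dom C g" "Cod C u = P" "r1 \<cdot> u = f" "r2 \<cdot> u = g"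
    by (rule orthonormal_product_pair[OF P(1), of f g]) (use f Y in auto)
  have su: "Star C u \<cdot> Star C r1 = Star C f" "Star C u \<cdot> Star C r2 = Star C g"
    using Star_Comp_eq[OF u(4)] Star_Comp_eq[OF u(5)] u r by simp_all
  have "Star C u \<cdot> d = Star C u \<cdot> ((Star C r1 \<cdot> r1 \<boxplus> Star C r2 \<cdot> r2) \<cdot> d)"
    using orthonormal_resolution[OF P(1)] P by simp
  also have "\<dots> = Star C f \<boxplus> Star C g"
    using u r P Y by (simp add: Comp_add add_Comp su)
  finally show ?thesis
    using mor_add_eq'[OF P, of u] u P by simp
qed

section \<open>Negatives\<close>

text \<open>If the diagonal of \<open>X\<close> is a kernel of \<open>f : X \<oplus> X \<rightarrow> Z\<close>, take \<open>a\<close> and \<open>b\<close> to be the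
  components of \<open>f\<close>: equality of morphisms into \<open>X\<close> is the linear condition
  \<open>a u + b v = 0\<close>. In effect \<open>b = - a\<close> with \<open>a\<close> monic.\<close>

lemma equality_linear:
  assumes X: "X \<in> Ob C"
  obtains a b where "a \<in> Mor C" "b \<in> Mor C" "Dom C a = X" "Dom C b = X" "Cod C b = Cod C a"
    "a \<boxplus> b = zero_mor C X (Cod C a)"
    "\<And>u v. \<lbrakk>u \<in> Mor C; v \<in> Mor C; Cod C u = X; Cod C v = X; Dom C u = Dom C v;
       a \<cdot> u \<boxplus> b \<cdot> v = zero_mor C (Dom C v) (Cod C a)\<rbrakk> \<Longrightarrow> u = v"
proof -
  obtain P r1 r2 d where P: "orthonormal_product C X X P r1 r2"
    and d: "d \<in> Mor C" "Dom C d = X" "Cod C d = P" "r1 \<cdot> d = Ident C X" "r2 \<cdot> d = Ident C X"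
    by (rule addition_data[OF X])
  note r = orthonormal_productD[OF P]
  obtain f where f: "kernel_of C f d"
    using diagonal_kernel[OF X P, of d] d by (auto simp: homset_def)
  have f': "f \<in> Mor C" "Dom C f = P" "f \<cdot> d = zero_mor C X (Cod C f)"
    using f d unfolding kernel_of_def by auto
  have "f \<cdot> Star C r1 \<boxplus> f \<cdot> Star C r2 = f \<cdot> ((Star C r1 \<cdot> r1 \<boxplus> Star C r2 \<cdot> r2) \<cdot> d)"
    using f' r d X by (simp add: add_Comp Comp_add)
  then have 0: "f \<cdot> Star C r1 \<boxplus> f \<cdot> Star C r2 = zero_mor C X (Cod C f)"
    using orthonormal_resolution[OF P] f' d by simp
  have eq: "u = v" if u: "u \<in> Mor C" "v \<in> Mor C" "Cod C u = X" "Cod C v = X" "Dom C u = Dom C v"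
    and 0: "(f \<cdot> Star C r1) \<cdot> u \<boxplus> (f \<cdot> Star C r2) \<cdot> v = zero_mor C (Dom C v) (Cod C f)" for u v
  proof -
    define w where "w = Star C r1 \<cdot> u \<boxplus> Star C r2 \<cdot> v"
    have w: "w \<in> homset C (Dom C v) P" "r1 \<cdot> w = u" "r2 \<cdot> w = v"
      using u r by (auto simp: w_def homset_def Comp_add Comp_reduce[OF r(7)] Comp_reduce[OF r(8)]
        Comp_reduce[OF r(9)] Comp_reduce[OF r(10)])
    have "Dom C v \<in> Ob C" "f \<cdot> w = zero_mor C (Dom C v) (Cod C f)"
      using 0 u r f' by (auto simp: w_def Comp_add)
    then obtain h where h: "h \<in> homset C (Dom C v) X" "d \<cdot> h = w"
      using f w(1) f' d unfolding kernel_of_def by blast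
    have "r1 \<cdot> (d \<cdot> h) = h" "r2 \<cdot> (d \<cdot> h) = h"
      using Comp_reduce[OF d(4), of h] Comp_reduce[OF d(5), of h] h r d by (auto simp: homset_def)
    then show ?thesis using h w by simp
  qed
  show thesis
    by (rule that[of "f \<cdot> Star C r1" "f \<cdot> Star C r2"]) (use f' r 0 eq in auto)
qed

text \<open>The diagonal \<open>d : X \<rightarrow> X \<oplus> X\<close> is a kernel of some \<open>f\<close>. Let \<open>n\<close> be an isometric kernel
  of \<open>f\<close>, so that \<open>n = d t\<close> with \<open>t\<close> invertible, and \<open>m\<close> an isometric kernel of \<open>d*\<close>, with
  components \<open>m\<^sub>1\<close> and \<open>m\<^sub>2\<close>. Then \<open>n n* + m m* = 1\<close>, whose off-diagonal entry reads
  \<open>t t* + m\<^sub>1 m\<^sub>2* = 0\<close>. Cancelling the invertible \<open>t t*\<close> gives a negative of \<open>1\<close>.\<close>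

lemma ex_negative_Ident:
  assumes X: "X \<in> Ob C"
  obtains v where "v \<in> Mor C" "Dom C v = X" "Cod C v = X" "Ident C X \<boxplus> v = zero_mor C X X"
proof -
  obtain P r1 r2 d where P: "orthonormal_product C X X P r1 r2"
    and d: "d \<in> Mor C" "Dom C d = X" "Cod C d = P" "r1 \<cdot> d = Ident C X" "r2 \<cdot> d = Ident C X"
    by (rule addition_data[OF X])
  note r = orthonormal_productD[OF P]
  have Pob: "P \<in> Ob C" using r by auto
  obtain f where f: "kernel_of C f d"
    using diagonal_kernel[OF X P, of d] d by (auto simp: homset_def)
  have f': "f \<in> Mor C" "Dom C f = P" "f \<cdot> d = zero_mor C X (Cod C f)"
    using f d unfolding kernel_of_def by auto
  obtain n where n: "n \<in> Mor C" "Cod C n = P" "f \<cdot> n = zero_mor C (Dom C n) (Cod C f)"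
    "Star C n \<cdot> n = Ident C (Dom C n)"
    and nfac: "\<And>g. \<lbrakk>g \<in> Mor C; Cod C g = P; f \<cdot> g = zero_mor C (Dom C g) (Cod C f)\<rbrakk>
       \<Longrightarrow> n \<cdot> (Star C n \<cdot> g) = g"
    by (rule isometric_kernel[OF f'(1,2) refl]) auto
  obtain m where m: "m \<in> Mor C" "Cod C m = P" "Star C d \<cdot> m = zero_mor C (Dom C m) X"
    "Star C m \<cdot> m = Ident C (Dom C m)"
    and mfac: "\<And>g. \<lbrakk>g \<in> Mor C; Cod C g = P; Star C d \<cdot> g = zero_mor C (Dom C g) X\<rbrakk>
       \<Longrightarrow> m \<cdot> (Star C m \<cdot> g) = g"
    by (rule isometric_kernel[of "Star C d" P X]) (use d in auto)
  have ob: "Dom C n \<in> Ob C" "Dom C m \<in> Ob C" using n m by auto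
  obtain t where t: "t \<in> homset C (Dom C n) X" "d \<cdot> t = n"
  proof -
    have "n \<in> homset C (Dom C n) P" using n by (simp add: homset_def)
    then show thesis using f n(3) f' d ob that unfolding kernel_of_def by blast
  qed
  have t': "t \<in> Mor C" "Dom C t = Dom C n" "Cod C t = X" using t by (auto simp: homset_def)
  define s where "s = Star C n \<cdot> d"
  have s: "s \<in> Mor C" "Dom C s = X" "Cod C s = Dom C n" "n \<cdot> s = d"
    using n d nfac[OF d(1,3)] f' by (auto simp: s_def)
  have rn: "r1 \<cdot> n = t" "r2 \<cdot> n = t"
    using Comp_reduce[OF d(4), of t] Comp_reduce[OF d(5), of t] t' t(2) r d by auto
  have ts: "t \<cdot> s = Ident C X"
    using Comp_reduce[OF rn(1), of s] s d n r t' by simp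
  have st: "s \<cdot> t = Ident C (Dom C n)"
    using n t' t d by (simp add: s_def)
  have nm: "Star C n \<cdot> m = zero_mor C (Dom C m) (Dom C n)"
  proof -
    have "Star C n = Star C t \<cdot> Star C d" using Star_Comp_eq[OF t(2)] t' d by simp
    then show ?thesis using m t' d ob by simp
  qed
  have mn: "Star C m \<cdot> n = zero_mor C (Dom C n) (Dom C m)"
    using Star_Comp_eq[OF nm] m n ob by simp
  define e where "e = n \<cdot> Star C n \<boxplus> m \<cdot> Star C m"
  have e: "e \<in> Mor C" "Dom C e = P" "Cod C e = P" using n m by (auto simp: e_def)
  have en: "e \<cdot> n = n" "e \<cdot> m = m"
    using n m nm mn ob Pob by (simp_all add: e_def add_Comp)
  \<comment> \<open>To prove \<open>e = 1\<close>, it suffices that \<open>c = a + b e\<close> vanishes. It does so on \<open>n\<close>, hence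
     on \<open>d\<close>, and on \<open>m\<close>; so \<open>c*\<close> factors through the kernel \<open>m\<close> of \<open>d*\<close> by \<open>m* c* = 0\<close>.\<close>
  obtain a b where ab: "a \<in> Mor C" "b \<in> Mor C" "Dom C a = P" "Dom C b = P" "Cod C b = Cod C a"
    "a \<boxplus> b = zero_mor C P (Cod C a)"
    and eqI: "\<And>u v. \<lbrakk>u \<in> Mor C; v \<in> Mor C; Cod C u = P; Cod C v = P; Dom C u = Dom C v;
       a \<cdot> u \<boxplus> b \<cdot> v = zero_mor C (Dom C v) (Cod C a)\<rbrakk> \<Longrightarrow> u = v"
    by (fact equality_linear[OF Pob])
  define c where "c = a \<boxplus> b \<cdot> e"
  have c: "c \<in> Mor C" "Dom C c = P" "Cod C c = Cod C a" using ab e by (auto simp: c_def)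
  have cn: "c \<cdot> g = zero_mor C (Dom C g) (Cod C a)" if g: "g \<in> Mor C" "Cod C g = P" "e \<cdot> g = g" for g
  proof -
    have "c \<cdot> g = (a \<boxplus> b) \<cdot> g" using g ab(1-5) e by (simp add: c_def add_Comp)
    then show ?thesis using ab g by simp
  qed
  have "c \<cdot> d = (c \<cdot> n) \<cdot> s" using c n s by simp
  then have "c \<cdot> d = zero_mor C X (Cod C a)"
    using cn[OF n(1,2) en(1)] s ab by simp
  from Star_Comp_eq[OF this] have "Star C d \<cdot> Star C c = zero_mor C (Cod C a) X"
    using c d ab X by simp
  then have "m \<cdot> (Star C m \<cdot> Star C c) = Star C c" using mfac[of "Star C c"] c by simp
  moreover have "Star C m \<cdot> Star C c = zero_mor C (Cod C a) (Dom C m)"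
    using Star_Comp_eq[OF cn[OF m(1,2) en(2)]] m c ab ob by simp
  ultimately have "Star C c = zero_mor C (Cod C a) P" using m ab by simp
  from arg_cong[OF this, of "Star C"] have c0: "c = zero_mor C P (Cod C a)" using c ab Pob by simp
  have "Ident C P = e"
    by (rule eqI) (use e Pob ab c0 in \<open>simp_all flip: c_def\<close>)
  then have "r1 \<cdot> (Ident C P \<cdot> Star C r2) = r1 \<cdot> (e \<cdot> Star C r2)" by simp
  also have "r1 \<cdot> (e \<cdot> Star C r2) = (r1 \<cdot> n) \<cdot> Star C (r2 \<cdot> n) \<boxplus> (r1 \<cdot> m) \<cdot> Star C (r2 \<cdot> m)"
    using r n m by (simp add: e_def add_Comp Comp_add)
  finally have tw: "t \<cdot> Star C t \<boxplus> (r1 \<cdot> m) \<cdot> Star C (r2 \<cdot> m) = zero_mor C X X"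
    using rn r by simp
  define w where "w = (r1 \<cdot> m) \<cdot> Star C (r2 \<cdot> m)"
  have w: "w \<in> Mor C" "Dom C w = X" "Cod C w = X" using r m by (auto simp: w_def)
  have tsts: "(t \<cdot> Star C t) \<cdot> (Star C s \<cdot> s) = Ident C X"
  proof -
    have "Star C t \<cdot> Star C s = Ident C (Dom C n)"
      using Star_Comp_eq[OF st] s t' ob by simp
    then have "Star C t \<cdot> (Star C s \<cdot> s) = s" using Comp_reduce s t' by simp
    then show ?thesis using ts s t' by simp
  qed
  have "(t \<cdot> Star C t \<boxplus> w) \<cdot> (Star C s \<cdot> s) = Ident C X \<boxplus> w \<cdot> (Star C s \<cdot> s)"
    by (subst add_Comp) (use t' s w tsts in simp_all)
  then have 1: "Ident C X \<boxplus> w \<cdot> (Star C s \<cdot> s) = zero_mor C X X"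
    using tw[folded w_def] s X by simp
  show thesis
    by (rule that[of "w \<cdot> (Star C s \<cdot> s)"]) (use w s 1 in simp_all)
qed

lemma ex_negative:
  assumes f: "f \<in> Mor C" "Dom C f = X" "Cod C f = Y"
  obtains g where "g \<in> Mor C" "Dom C g = X" "Cod C g = Y" "g \<boxplus> f = zero_mor C X Y"
proof -
  have ob: "X \<in> Ob C" "Y \<in> Ob C" using f by auto
  obtain v where v: "v \<in> Mor C" "Dom C v = Y" "Cod C v = Y" "Ident C Y \<boxplus> v = zero_mor C Y Y"
    by (rule ex_negative_Ident[OF ob(2)])
  have "f \<boxplus> v \<cdot> f = (Ident C Y \<boxplus> v) \<cdot> f"
    using v(1-3) f ob by (simp add: add_Comp)
  then have "f \<boxplus> v \<cdot> f = zero_mor C X Y" using v f ob by simp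
  then have "v \<cdot> f \<boxplus> f = zero_mor C X Y" using add_commute[of f "v \<cdot> f"] v f by simp
  then show thesis using that[of "v \<cdot> f"] v f by simp
qed

lemma ex_difference:
  assumes "f \<in> Mor C" "g \<in> Mor C" "Dom C f = Dom C g" "Cod C f = Cod C g"
  obtains h where "h \<in> Mor C" "Dom C h = Dom C g" "Cod C h = Cod C g" "f = h \<boxplus> g"
proof -
  obtain k where k: "k \<in> Mor C" "Dom C k = Dom C g" "Cod C k = Cod C g"
    "k \<boxplus> g = zero_mor C (Dom C g) (Cod C g)"
    by (rule ex_negative[OF assms(2) refl refl])
  have "f = (f \<boxplus> k) \<boxplus> g" using k assms by (simp add: add_assoc)
  then show thesis using that[of "f \<boxplus> k"] k assms by simp
qed

lemma add_right_cancel: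
  assumes "f \<in> Mor C" "g \<in> Mor C" "h \<in> Mor C" "Dom C f = Dom C h" "Dom C g = Dom C h"
    "Cod C f = Cod C h" "Cod C g = Cod C h" and eq: "f \<boxplus> h = g \<boxplus> h"
  shows "f = g"
proof -
  obtain k where k: "k \<in> Mor C" "Dom C k = Dom C h" "Cod C k = Cod C h"
    "k \<boxplus> h = zero_mor C (Dom C h) (Cod C h)"
    by (rule ex_negative[OF assms(3) refl refl])
  have hk: "h \<boxplus> k = zero_mor C (Dom C h) (Cod C h)" using add_commute[of h k] k assms(3) by simp
  have *: "(f' \<boxplus> h) \<boxplus> k = f'"
    if "f' \<in> Mor C" "Dom C f' = Dom C h" "Cod C f' = Cod C h" for f'
  proof -
    have "(f' \<boxplus> h) \<boxplus> k = f' \<boxplus> (h \<boxplus> k)"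
      by (rule add_assoc) (use k(1-3) assms(3) that in simp_all)
    then show ?thesis unfolding hk using that by simp
  qed
  show ?thesis
    using *[OF assms(1,4,6)] *[OF assms(2,5,7)] unfolding eq by (rule trans[OF sym])
qed

section \<open>Endomorphisms and their order\<close>

lemma End_simps [simp]:
  "carrier (End C A) = homset C A A" "add (End C A) = mor_add C" "mult (End C A) = Comp C"
  "zero (End C A) = zero_mor C A A" "one (End C A) = Ident C A"
  by (simp_all add: End_def)

lemma ring_End:
  assumes A: "A \<in> Ob C"
  shows "ring (End C A)"
proof (rule ringI)
  have neg: "\<exists>g. g \<in> Mor C \<and> Dom C g = A \<and> Cod C g = A \<and> g \<boxplus> f = zero_mor C A A"
    if "f \<in> Mor C" "Dom C f = A" "Cod C f = A" for f
    using ex_negative[OF that] by metis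
  show "abelian_group (End C A)"
    using A neg by (intro abelian_groupI) (auto simp: homset_def add_assoc intro: add_commute)
  show "monoid (End C A)" using A by (intro monoidI) (auto simp: homset_def)
qed (use A in \<open>auto simp: homset_def add_Comp Comp_add\<close>)

lemma hermitianD:
  assumes "hermitian C A a"
  shows "a \<in> Mor C" "Dom C a = A" "Cod C a = A" "Star C a = a"
  using assms by (auto simp: hermitian_def homset_def)

text \<open>A sum of positive elements is positive; the summand \<open>h\<close> is recovered from the pairing \<open>u\<close>
  of \<open>h\<close> and \<open>k\<close> by a projection \<open>c\<close>.\<close>

lemma positive_add:
  assumes h: "h \<in> Mor C" "k \<in> Mor C" "Dom C h = A" "Dom C k = A"
  obtains u c where "u \<in> Mor C" "Dom C u = A" "Star C u \<cdot> u = Star C h \<cdot> h \<boxplus> Star C k \<cdot> k"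
    "c \<in> Mor C" "Dom C c = Cod C u" "c \<cdot> u = h"
proof -
  have ob: "Cod C h \<in> Ob C" "Cod C k \<in> Ob C" "A \<in> Ob C" using h by auto
  obtain P r1 r2 where P: "orthonormal_product C (Cod C h) (Cod C k) P r1 r2"
    using ex_orthonormal_product[OF ob(1,2)] by blast
  note r = orthonormal_productD[OF P]
  obtain u where u: "u \<in> Mor C" "Dom C u = A" "Cod C u = P" "r1 \<cdot> u = h" "r2 \<cdot> u = k"
    by (rule orthonormal_product_pair[OF P, of h k]) (use h in auto)
  have "Star C u \<cdot> Star C r1 = Star C h" "Star C u \<cdot> Star C r2 = Star C k"
    using Star_Comp_eq[OF u(4)] Star_Comp_eq[OF u(5)] u(1-3) r by simp_all
  note su = this[THEN Comp_reduce]
  have "Star C u \<cdot> u = Star C u \<cdot> ((Star C r1 \<cdot> r1 \<boxplus> Star C r2 \<cdot> r2) \<cdot> u)"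
    using orthonormal_resolution[OF P] u by simp
  also have "\<dots> = Star C h \<cdot> h \<boxplus> Star C k \<cdot> k"
    using u r h ob su by (simp add: add_Comp Comp_add)
  finally show thesis using that[of u r1] u r by simp
qed

lemma positive_add_eq_zeroD:
  assumes h: "h \<in> Mor C" "k \<in> Mor C" "Dom C h = A" "Dom C k = A" "Cod C h = X"
    and 0: "Star C h \<cdot> h \<boxplus> Star C k \<cdot> k = zero_mor C A A"
  shows "h = zero_mor C A X"
proof -
  obtain u c where u: "u \<in> Mor C" "Dom C u = A" "Star C u \<cdot> u = Star C h \<cdot> h \<boxplus> Star C k \<cdot> k"
    "c \<in> Mor C" "Dom C c = Cod C u" "c \<cdot> u = h"
    by (rule positive_add[OF h(1-4)])
  have "u = zero_mor C A (Cod C u)" using Star_Comp_self_eq_zeroD[OF u(1)] u(2,3) 0 by simp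
  then have "c \<cdot> u = zero_mor C A (Cod C c)" using u by (metis Comp_zero Dom_in_Ob)
  moreover have "Cod C c = X" using u h(5) Comp_typing(3)[of u c] by simp
  ultimately show ?thesis using u by simp
qed

text \<open>The hypothesis says that \<open>x\<close> is orthogonal to \<open>z = y - x\<close>.\<close>

lemma pythagoras:
  assumes "x \<in> Mor C" "y \<in> Mor C" "Dom C x = A" "Dom C y = A" "Cod C x = X" "Cod C y = X"
    and xy: "Star C x \<cdot> y = Star C x \<cdot> x"
  obtains z where "z \<in> Mor C" "Dom C z = A" "Cod C z = X" "y = z \<boxplus> x"
    "Star C y \<cdot> y = Star C z \<cdot> z \<boxplus> Star C x \<cdot> x"
proof -
  have ob: "A \<in> Ob C" "X \<in> Ob C" using assms by auto
  obtain z where z: "z \<in> Mor C" "Dom C z = A" "Cod C z = X" "y = z \<boxplus> x"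
    using ex_difference[of y x] assms by metis
  have "Star C x \<cdot> z \<boxplus> Star C x \<cdot> x = zero_mor C A A \<boxplus> Star C x \<cdot> x"
    using xy z assms by (simp add: Comp_add)
  then have xz: "Star C x \<cdot> z = zero_mor C A A"
    by (rule add_right_cancel[rotated -1]) (use z assms ob in simp_all)
  have zx: "Star C z \<cdot> x = zero_mor C A A"
    using Star_Comp_eq[OF xz] z(1-3) assms(1-6) ob by simp
  have "Star C (z \<boxplus> x) \<cdot> (z \<boxplus> x) = Star C z \<cdot> z \<boxplus> Star C x \<cdot> x"
    using z(1-3) assms(1-6) ob xz zx by (simp add: Comp_add add_Comp)
  with z that show thesis by simp
qed

text \<open>The order on Hermitian endomorphisms, expressed without subtraction.\<close>

lemma herm_order_le_iff:
  assumes A: "A \<in> Ob C"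
  shows "f \<sqsubseteq>\<^bsub>herm_order C A\<^esub> g \<longleftrightarrow> hermitian C A f \<and> hermitian C A g \<and>
    (\<exists>h\<in>Mor C. Dom C h = A \<and> g = f \<boxplus> Star C h \<cdot> h)"
proof -
  interpret E: ring "End C A" by (rule ring_End[OF A])
  have eq: "g \<ominus>\<^bsub>End C A\<^esub> f = p \<longleftrightarrow> g = f \<boxplus> p"
    if "f \<in> homset C A A" "g \<in> homset C A A" "p \<in> homset C A A" for p
    using that E.add.inv_solve_right[of p g f] E.a_comm[of p f]
    by (auto simp: E.minus_eq)
  have p: "Star C h \<cdot> h \<in> homset C A A" if "h \<in> homset C A X" for h X
    using that by (simp add: homset_def)
  show ?thesis
    using eq[OF _ _ p] unfolding herm_order_def hermitian_def
    by (auto simp: homset_def) (metis Cod_in_Ob)+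
qed

lemma Upper_herm_order_iff:
  "u \<in> Upper (herm_order C A) S \<longleftrightarrow>
    hermitian C A u \<and> (\<forall>x\<in>S. hermitian C A x \<longrightarrow> x \<sqsubseteq>\<^bsub>herm_order C A\<^esub> u)"
  by (auto simp: Upper_def herm_order_def)

lemma is_supremum_iff:
  "is_supremum C A S s \<longleftrightarrow> s \<in> Upper (herm_order C A) S \<and>
    (\<forall>u\<in>Upper (herm_order C A) S. s \<sqsubseteq>\<^bsub>herm_order C A\<^esub> u)"
  by (auto simp: is_supremum_def least_def Upper_def)

lemma partial_sums_cong:
  assumes A: "A \<in> Ob C" and ab: "\<And>j. j \<in> J \<Longrightarrow> a j = b j" and b: "\<And>j. j \<in> J \<Longrightarrow> b j \<in> homset C A A"
  shows "partial_sums C A J a = partial_sums C A J b"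
proof -
  interpret E: ring "End C A" by (rule ring_End[OF A])
  have "finsum (End C A) a F = finsum (End C A) b F" if "F \<subseteq> J" for F
    using that ab b by (intro E.finsum_cong') auto
  then show ?thesis unfolding partial_sums_def by metis
qed

text \<open>Zero terms do not contribute to the partial sums, and an injective change of indices does not
  affect them.\<close>

lemma partial_sums_reindex:
  assumes A: "A \<in> Ob C" and inj: "inj_on x J0" and J0: "J0 \<subseteq> J"
    and a: "\<And>j. j \<in> J \<Longrightarrow> a (x j) \<in> homset C A A"
    and 0: "\<And>j. j \<in> J - J0 \<Longrightarrow> a (x j) = zero_mor C A A"
  shows "partial_sums C A (x ` J0) a = partial_sums C A J (\<lambda>j. a (x j))"
proof -
  interpret E: ring "End C A" by (rule ring_End[OF A])
  have reindex: "finsum (End C A) a (x ` G) = finsum (End C A) (\<lambda>j. a (x j)) G" if "G \<subseteq> J0" for G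
    using that a J0 inj by (intro E.finsum_reindex) (auto intro: inj_on_subset)
  have restrict: "finsum (End C A) (\<lambda>j. a (x j)) (F \<inter> J0) = finsum (End C A) (\<lambda>j. a (x j)) F"
    if "finite F" "F \<subseteq> J" for F
    using that a 0 by (intro E.add.finprod_mono_neutral_cong_left) auto
  show ?thesis
  proof (intro equalityI subsetI)
    fix p assume "p \<in> partial_sums C A (x ` J0) a"
    then obtain F where F: "finite F" "F \<subseteq> x ` J0" "p = finsum (End C A) a F"
      by (auto simp: partial_sums_def)
    then obtain G where G: "G \<subseteq> J0" "finite G" "F = x ` G" by (meson finite_subset_image)
    then show "p \<in> partial_sums C A J (\<lambda>j. a (x j))"
      using F reindex[OF G(1)] J0 by (auto simp: partial_sums_def)
  next
    fix p assume "p \<in> partial_sums C A J (\<lambda>j. a (x j))"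
    then obtain F where F: "finite F" "F \<subseteq> J" "p = finsum (End C A) (\<lambda>j. a (x j)) F"
      by (auto simp: partial_sums_def)
    then have "p = finsum (End C A) a (x ` (F \<inter> J0))" using reindex[of "F \<inter> J0"] restrict[of F] by simp
    then show "p \<in> partial_sums C A (x ` J0) a"
      using F by (auto simp: partial_sums_def)
  qed
qed

section \<open>Order sums over arbitrary index types\<close>

text \<open>The nonzero members of an \<open>\<ell>\<^sup>2\<close>-family are pairwise distinct, hence may be indexed by
  themselves, and order sums are insensitive to the zero members.\<close>

lemma ex_order_sum:
  fixes J :: "'j set"
  assumes oc: "orthogonally_complete C" and A: "A \<in> Ob C" and X: "X \<in> Ob C"
    and l2: "l2_family C A X J x"
  obtains s where "is_order_sum C A X J x s"
proof -
  define J0 where "J0 = {j \<in> J. Star C (x j) \<cdot> x j \<noteq> zero_mor C A A}"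
  have x: "x j \<in> Mor C" "Dom C (x j) = A" "Cod C (x j) = X" if "j \<in> J" for j
    using l2 that by (auto simp: l2_family_def homset_def)
  have orth: "Star C (x j) \<cdot> x k = zero_mor C A A" if "j \<in> J" "k \<in> J" "j \<noteq> k" for j k
    using l2 that by (auto simp: l2_family_def)
  have inj: "inj_on x J0"
  proof (rule inj_onI, rule ccontr)
    fix j k assume jk: "j \<in> J0" "k \<in> J0" "x j = x k" "j \<noteq> k"
    then have "Star C (x j) \<cdot> x k = zero_mor C A A" using orth[of j k] by (simp add: J0_def)
    then show False using jk by (auto simp: J0_def)
  qed
  have ps: "partial_sums C A (x ` J0) (\<lambda>y. Star C y \<cdot> y)
      = partial_sums C A J (\<lambda>j. Star C (x j) \<cdot> x j)"
    by (rule partial_sums_reindex[OF A inj]) (auto simp: J0_def homset_def x)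
  have "l2_family C A X (x ` J0) (\<lambda>y. y)"
    using l2 orth ps by (auto simp: l2_family_def J0_def)
  then obtain s where s: "is_order_sum C A X (x ` J0) (\<lambda>y. y) s"
    using oc A X unfolding orthogonally_complete_def by blast
  have s': "s \<in> Mor C" "Dom C s = A" "Cod C s = X" using s by (auto simp: is_order_sum_def homset_def)
  have "Star C s \<cdot> x j = Star C (x j) \<cdot> x j" if j: "j \<in> J" for j
  proof (cases "j \<in> J0")
    case True
    then show ?thesis using s by (auto simp: is_order_sum_def)
  next
    case False
    then have "Star C (x j) \<cdot> x j = zero_mor C A A" using j by (auto simp: J0_def)
    moreover from this have "x j = zero_mor C A X"
      using Star_Comp_self_eq_zeroD[of "x j"] x[OF j] by simp
    ultimately show ?thesis using s' A by simp
  qed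
  then have "is_order_sum C A X J x s"
    using s ps by (auto simp: is_order_sum_def has_order_sum_def)
  then show thesis by (rule that)
qed

section \<open>The universal property of an \<open>\<ell>\<^sup>2\<close>-biproduct\<close>

lemma l2_biproductD:
  assumes "l2_biproduct C J Xs X r"
  shows "X \<in> Ob C" and "is_supremum C X (partial_sums C X J (\<lambda>j. Star C (r j) \<cdot> r j)) (Ident C X)"
    and "\<And>j. j \<in> J \<Longrightarrow> r j \<in> Mor C" "\<And>j. j \<in> J \<Longrightarrow> Dom C (r j) = X"
    "\<And>j. j \<in> J \<Longrightarrow> Cod C (r j) = Xs j" "\<And>j. j \<in> J \<Longrightarrow> Xs j \<in> Ob C"
    "\<And>j. j \<in> J \<Longrightarrow> r j \<cdot> Star C (r j) = Ident C (Xs j)"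
    "\<And>j k. \<lbrakk>j \<in> J; k \<in> J; j \<noteq> k\<rbrakk> \<Longrightarrow> r j \<cdot> Star C (r k) = zero_mor C (Xs k) (Xs j)"
  using assms by (auto simp: l2_biproduct_def span_def has_order_sum_def homset_def)

text \<open>Let \<open>k\<close> be an isometric kernel of \<open>h*\<close>. If all \<open>r\<^sub>j h\<close> vanish, then the projection \<open>p = k k*\<close>
  satisfies \<open>r\<^sub>j p = r\<^sub>j\<close>, hence bounds all partial sums of \<open>\<Sum>j. r\<^sub>j* r\<^sub>j = 1\<close>, so that
  \<open>1 \<le> p\<close>. But \<open>h* p h = 0\<close>.\<close>

lemma l2_biproduct_jointly_faithful:
  assumes bi: "l2_biproduct C J Xs X r"
    and h: "h \<in> Mor C" "Dom C h = Y" "Cod C h = X"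
    and rh: "\<And>j. j \<in> J \<Longrightarrow> r j \<cdot> h = zero_mor C Y (Xs j)"
  shows "h = zero_mor C Y X"
proof -
  note r = l2_biproductD[OF bi]
  have Y: "Y \<in> Ob C" using h by auto
  interpret E: ring "End C X" by (rule ring_End[OF r(1)])
  obtain k where k: "k \<in> Mor C" "Cod C k = X" "Star C h \<cdot> k = zero_mor C (Dom C k) Y"
    "Star C k \<cdot> k = Ident C (Dom C k)"
    and kfac: "\<And>g. \<lbrakk>g \<in> Mor C; Cod C g = X; Star C h \<cdot> g = zero_mor C (Dom C g) Y\<rbrakk>
      \<Longrightarrow> k \<cdot> (Star C k \<cdot> g) = g"
    by (rule isometric_kernel[of "Star C h" X Y]) (use h in auto)
  have kob: "Dom C k \<in> Ob C" using k by auto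
  have kh: "Star C k \<cdot> h = zero_mor C Y (Dom C k)"
    using Star_Comp_eq[OF k(3)] h k Y kob by simp
  define p where "p = k \<cdot> Star C k"
  have p: "p \<in> Mor C" "Dom C p = X" "Cod C p = X" "Star C p = p" using k by (auto simp: p_def)
  have pp: "p \<cdot> p = p" using k kob Comp_reduce[OF k(4), of "Star C k"] by (simp add: p_def)
  have ph: "p \<cdot> h = zero_mor C Y X" using k h kh Y by (simp add: p_def)
  have rp: "r j \<cdot> p = r j" if j: "j \<in> J" for j
  proof -
    have "Star C h \<cdot> Star C (r j) = zero_mor C (Xs j) Y"
      using Star_Comp_eq[OF rh[OF j]] r(3-6)[OF j] h Y by simp
    then have "p \<cdot> Star C (r j) = Star C (r j)"
      using kfac[of "Star C (r j)"] r(3-6)[OF j] k by (simp add: p_def)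
    from Star_Comp_eq[OF this] show ?thesis using p r(3-6)[OF j] by simp
  qed
  have "p \<in> Upper (herm_order C X) (partial_sums C X J (\<lambda>j. Star C (r j) \<cdot> r j))"
    unfolding Upper_herm_order_iff
  proof (intro conjI ballI impI)
    show hp: "hermitian C X p" using p by (simp add: hermitian_def homset_def)
    fix q assume q: "q \<in> partial_sums C X J (\<lambda>j. Star C (r j) \<cdot> r j)" "hermitian C X q"
    then obtain F where F: "finite F" "F \<subseteq> J" "q = finsum (End C X) (\<lambda>j. Star C (r j) \<cdot> r j) F"
      by (auto simp: partial_sums_def)
    note q' = hermitianD[OF q(2)]
    have "q \<sqsubseteq>\<^bsub>herm_order C X\<^esub> Ident C X"
      using r(2) q by (auto simp: is_supremum_iff Upper_herm_order_iff)
    then obtain z where z: "z \<in> Mor C" "Dom C z = X" "Ident C X = q \<boxplus> Star C z \<cdot> z"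
      using herm_order_le_iff[OF r(1)] by auto
    have "q \<cdot> p = finsum (End C X) (\<lambda>j. Star C (r j) \<cdot> r j \<cdot> p) F"
      using E.finsum_ldistr[OF F(1), of p "\<lambda>j. Star C (r j) \<cdot> r j"] F p r(3,4)
      by (auto simp: homset_def Pi_iff subset_iff)
    also have "\<dots> = q"
      unfolding F(3)
      by (intro E.finsum_cong') (use F(2) p r(3,4) rp in \<open>auto simp: homset_def subset_iff\<close>)
    finally have qp: "q \<cdot> p = q" .
    have pq: "p \<cdot> q = q" using Star_Comp_eq[OF qp] p q' by simp
    have "p = p \<cdot> (Ident C X \<cdot> p)" using p pp by simp
    also have "\<dots> = q \<boxplus> Star C (z \<cdot> p) \<cdot> (z \<cdot> p)"
      unfolding z(3) using p q' qp pq z(1,2) by (simp add: add_Comp Comp_add)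
    finally show "q \<sqsubseteq>\<^bsub>herm_order C X\<^esub> p"
      unfolding herm_order_le_iff[OF r(1)] using hp q(2) p z(1,2)
      by (intro conjI bexI[of _ "z \<cdot> p"]) auto
  qed
  then have "Ident C X \<sqsubseteq>\<^bsub>herm_order C X\<^esub> p" using r(2) by (simp add: is_supremum_iff)
  then obtain q where q: "q \<in> Mor C" "Dom C q = X" "p = Ident C X \<boxplus> Star C q \<cdot> q"
    using herm_order_le_iff[OF r(1)] by auto
  have "zero_mor C Y Y = Star C h \<cdot> (p \<cdot> h)" using ph h Y by simp
  also have "\<dots> = Star C h \<cdot> h \<boxplus> Star C (q \<cdot> h) \<cdot> (q \<cdot> h)"
    unfolding q(3) using h q(1,2) r(1) by (simp add: add_Comp Comp_add)
  finally show ?thesis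
    using h q(1,2) by (intro positive_add_eq_zeroD[of h "q \<cdot> h"]) auto
qed

lemma l2_biproduct_unique:
  assumes bi: "l2_biproduct C J Xs X r"
    and g: "g \<in> homset C Y X" "g' \<in> homset C Y X"
    and eq: "\<And>j. j \<in> J \<Longrightarrow> r j \<cdot> g = r j \<cdot> g'"
  shows "g = g'"
proof -
  note r = l2_biproductD[OF bi]
  have g': "g \<in> Mor C" "Dom C g = Y" "Cod C g = X" "g' \<in> Mor C" "Dom C g' = Y" "Cod C g' = X"
    using g by (auto simp: homset_def)
  obtain h where h: "h \<in> Mor C" "Dom C h = Y" "Cod C h = X" "g = h \<boxplus> g'"
    using ex_difference[of g g'] g' by metis
  have "r j \<cdot> h = zero_mor C Y (Xs j)" if j: "j \<in> J" for j
  proof (rule add_right_cancel)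
    show "r j \<cdot> h \<boxplus> r j \<cdot> g' = zero_mor C Y (Xs j) \<boxplus> r j \<cdot> g'"
      using eq[OF j] h g'(4-6) r(3-6)[OF j] by (simp add: Comp_add)
  qed (use h g' r(3-6)[OF j] Dom_in_Ob[OF g'(1)] in simp_all)
  from l2_biproduct_jointly_faithful[OF bi h(1-3) this] show ?thesis
    using h g' by simp
qed

text \<open>If \<open>s\<close> is an order sum of the \<open>r\<^sub>j* g\<^sub>j\<close>, subtracting finitely many of them from \<open>s\<close>
  leaves a remainder \<open>y\<close>, to which Pythagoras' theorem applies.\<close>

lemma order_sum_remainder:
  assumes bi: "l2_biproduct C J Xs X r"
    and g: "\<And>j. j \<in> J \<Longrightarrow> g j \<in> homset C Y (Xs j)"
    and s: "s \<in> homset C Y X"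
    and sx: "\<And>j. j \<in> J \<Longrightarrow> Star C s \<cdot> (Star C (r j) \<cdot> g j) = Star C (g j) \<cdot> g j"
    and F: "finite F" "F \<subseteq> J"
  shows "\<exists>y\<in>homset C Y X.
    Star C s \<cdot> s = Star C y \<cdot> y \<boxplus> finsum (End C Y) (\<lambda>j. Star C (g j) \<cdot> g j) F \<and>
    (\<forall>j\<in>J. if j \<in> F then r j \<cdot> s = r j \<cdot> y \<boxplus> g j else r j \<cdot> s = r j \<cdot> y)"
  using F
proof (induction F rule: finite_induct)
  case empty
  have Y: "Y \<in> Ob C" by (rule homset_Ob[OF s])
  interpret E: ring "End C Y" by (rule ring_End[OF Y])
  show ?case
    using s E.finsum_empty[of "\<lambda>j. Star C (g j) \<cdot> g j"] by (intro bexI[of _ s]) (auto simp: homset_def)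
next
  case (insert k F)
  note r = l2_biproductD[OF bi]
  have Y: "Y \<in> Ob C" by (rule homset_Ob[OF s])
  interpret E: ring "End C Y" by (rule ring_End[OF Y])
  have g': "g j \<in> Mor C" "Dom C (g j) = Y" "Cod C (g j) = Xs j" if "j \<in> J" for j
    using g[OF that] by (auto simp: homset_def)
  have s': "s \<in> Mor C" "Dom C s = Y" "Cod C s = X" using s by (auto simp: homset_def)
  let ?S = "finsum (End C Y) (\<lambda>j. Star C (g j) \<cdot> g j)"
  have k: "k \<in> J" "F \<subseteq> J" using insert.prems by auto
  obtain y where y: "y \<in> Mor C" "Dom C y = Y" "Cod C y = X"
      and ys: "Star C s \<cdot> s = Star C y \<cdot> y \<boxplus> ?S F"
      and yF: "\<And>j. j \<in> F \<Longrightarrow> r j \<cdot> s = r j \<cdot> y \<boxplus> g j"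
      and yJ: "\<And>j. j \<in> J \<Longrightarrow> j \<notin> F \<Longrightarrow> r j \<cdot> s = r j \<cdot> y"
    using insert.IH[OF k(2)] k(2) unfolding homset_def by fastforce
  define x where "x = Star C (r k) \<cdot> g k"
  note rk = r(3-7)[OF k(1)] and gk = g'[OF k(1)]
  have x: "x \<in> Mor C" "Dom C x = Y" "Cod C x = X" using rk gk by (auto simp: x_def)
  have xx: "Star C x \<cdot> x = Star C (g k) \<cdot> g k"
    using rk gk Comp_reduce[OF rk(5), of "g k"] by (simp add: x_def)
  have xs: "Star C x \<cdot> s = Star C (g k) \<cdot> g k"
    using Star_Comp_eq[OF sx[OF k(1)]] rk gk s' by (simp add: x_def)
  have "Star C x \<cdot> y = Star C (g k) \<cdot> (r k \<cdot> y)" using rk gk y by (simp add: x_def)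
  also have "\<dots> = Star C (g k) \<cdot> (r k \<cdot> s)" using yJ[OF k(1) insert.hyps(2)] by simp
  also have "\<dots> = Star C x \<cdot> s" using rk gk s' by (simp add: x_def)
  finally have xy: "Star C x \<cdot> y = Star C x \<cdot> x" using xs xx by simp
  obtain z where z: "z \<in> Mor C" "Dom C z = Y" "Cod C z = X" "y = z \<boxplus> x"
    "Star C y \<cdot> y = Star C z \<cdot> z \<boxplus> Star C x \<cdot> x"
    by (rule pythagoras[OF x(1) y(1) x(2) y(2) x(3) y(3) xy])
  have G: "(\<lambda>j. Star C (g j) \<cdot> g j) \<in> J \<rightarrow> homset C Y Y" using g' by (auto simp: homset_def)
  then have SF: "?S F \<in> homset C Y Y" using E.finsum_closed[of "\<lambda>j. Star C (g j) \<cdot> g j" F] k(2) by auto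
  have "?S (insert k F) = Star C (g k) \<cdot> g k \<boxplus> ?S F"
    by (subst E.finsum_insert) (use insert.hyps G k in auto)
  then have 1: "Star C s \<cdot> s = Star C z \<cdot> z \<boxplus> ?S (insert k F)"
    using ys z(1-3,5) xx SF gk by (simp add: add_assoc homset_def)
  have "if j \<in> insert k F then r j \<cdot> s = r j \<cdot> z \<boxplus> g j else r j \<cdot> s = r j \<cdot> z" if j: "j \<in> J" for j
  proof -
    note rj = r(3-7)[OF j] and gj = g'[OF j]
    have ry: "r j \<cdot> y = r j \<cdot> z \<boxplus> r j \<cdot> x"
      unfolding z(4) using rj z(1-3) x by (simp add: Comp_add)
    show ?thesis
    proof (cases "j = k")
      case True
      have "r k \<cdot> x = g k" using rk gk Comp_reduce[OF rk(5), of "g k"] by (simp add: x_def)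
      then show ?thesis using True ry yJ[OF k(1) insert.hyps(2)] by simp
    next
      case False
      have "r j \<cdot> x = zero_mor C Y (Xs j)"
        using rj rk gk Comp_reduce[OF r(8)[OF j k(1) False], of "g k"] by (simp add: x_def)
      then have "r j \<cdot> y = r j \<cdot> z" using ry rj z(1-3) by simp
      then show ?thesis using False yF[of j] yJ[OF j] by auto
    qed
  qed
  then show ?case using 1 z(1-3) by (intro bexI[of _ z]) (auto simp: homset_def)
qed

text \<open>Let \<open>w = r\<^sub>j s - g\<^sub>j\<close>. The remainder of \<open>s\<close> after any finite subset containing \<open>j\<close> has
  \<open>j\<close>-th component \<open>w\<close>. Hence \<open>s* s - w* w\<close> still bounds the partial sums whose
  supremum is \<open>s* s\<close>, which forces \<open>w = 0\<close>.\<close>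

lemma order_sum_components:
  assumes bi: "l2_biproduct C J Xs X r"
    and g: "\<And>j. j \<in> J \<Longrightarrow> g j \<in> homset C Y (Xs j)"
    and s: "s \<in> homset C Y X"
    and sx: "\<And>j. j \<in> J \<Longrightarrow> Star C s \<cdot> (Star C (r j) \<cdot> g j) = Star C (g j) \<cdot> g j"
    and sup: "has_order_sum C Y J (\<lambda>j. Star C (g j) \<cdot> g j) (Star C s \<cdot> s)"
    and j: "j \<in> J"
  shows "r j \<cdot> s = g j"
proof -
  note rj = l2_biproductD(3-7)[OF bi j]
  have Y: "Y \<in> Ob C" by (rule homset_Ob[OF s])
  interpret E: ring "End C Y" by (rule ring_End[OF Y])
  have g': "g j \<in> Mor C" "Dom C (g j) = Y" "Cod C (g j) = Xs j" if "j \<in> J" for j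
    using g[OF that] by (auto simp: homset_def)
  note gj = g'[OF j]
  have s': "s \<in> Mor C" "Dom C s = Y" "Cod C s = X" using s by (auto simp: homset_def)
  let ?G = "\<lambda>j. Star C (g j) \<cdot> g j"
  let ?S = "finsum (End C Y) ?G"
  obtain w where w: "w \<in> Mor C" "Dom C w = Y" "Cod C w = Xs j" "r j \<cdot> s = w \<boxplus> g j"
    using ex_difference[of "r j \<cdot> s" "g j"] rj gj s' by auto
  obtain u where u: "u \<in> Mor C" "Dom C u = Y" "Cod C u = Y" "Star C s \<cdot> s = u \<boxplus> Star C w \<cdot> w"
    using ex_difference[of "Star C s \<cdot> s" "Star C w \<cdot> w"] s' w(1-3) by auto
  have "Star C u \<boxplus> Star C w \<cdot> w = Star C (Star C s \<cdot> s)"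
    unfolding u(4) using u(1-3) w(1-3) by simp
  also have "\<dots> = Star C s \<cdot> s" using s' by simp
  also note u(4)
  finally have "Star C u = u"
    by (rule add_right_cancel[rotated -1]) (use u w in simp_all)
  then have hu: "hermitian C Y u" using u by (simp add: hermitian_def homset_def)
  have "u \<in> Upper (herm_order C Y) (partial_sums C Y J ?G)"
    unfolding Upper_herm_order_iff
  proof (intro conjI ballI impI)
    show "hermitian C Y u" by (rule hu)
    fix q assume q: "q \<in> partial_sums C Y J ?G" "hermitian C Y q"
    then obtain F where F: "finite F" "F \<subseteq> J" "q = ?S F" by (auto simp: partial_sums_def)
    note q' = hermitianD[OF q(2)]
    obtain y where y: "y \<in> Mor C" "Dom C y = Y" "Cod C y = X"
      "Star C s \<cdot> s = Star C y \<cdot> y \<boxplus> ?S (insert j F)" "r j \<cdot> s = r j \<cdot> y \<boxplus> g j"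
      using order_sum_remainder[OF bi g s sx, of "insert j F"] F j unfolding homset_def by fastforce
    have ry: "r j \<cdot> y = w"
      by (rule add_right_cancel[of _ _ "g j"]) (use y w gj rj in simp_all)
    \<comment> \<open>Splitting off the \<open>j\<close>-th component \<open>x = r\<^sub>j* r\<^sub>j y\<close> of \<open>y\<close> shows that
       \<open>y* y - w* w\<close> is positive.\<close>
    define x where "x = Star C (r j) \<cdot> w"
    have x: "x \<in> Mor C" "Dom C x = Y" "Cod C x = X" using rj w by (auto simp: x_def)
    have xx: "Star C x \<cdot> x = Star C w \<cdot> w"
      using rj w(1-3) Comp_reduce[OF rj(5), of w] by (simp add: x_def)
    have xy: "Star C x \<cdot> y = Star C x \<cdot> x"
      unfolding xx using rj w(1-3) y(1-3) ry by (simp add: x_def)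
    obtain z where z: "z \<in> Mor C" "Dom C z = Y" "Cod C z = X"
      "Star C y \<cdot> y = Star C z \<cdot> z \<boxplus> Star C x \<cdot> x"
      by (rule pythagoras[OF x(1) y(1) x(2) y(2) x(3) y(3) xy])
    \<comment> \<open>If \<open>j\<close> is not in \<open>F\<close>, the sum over \<open>insert j F\<close> has the additional term \<open>g\<^sub>j* g\<^sub>j\<close>, which
       is absorbed into the positive remainder.\<close>
    obtain v where v: "v \<in> Mor C" "Dom C v = Y" "Star C z \<cdot> z \<boxplus> ?S (insert j F) = q \<boxplus> Star C v \<cdot> v"
    proof (cases "j \<in> F")
      case True
      then show thesis
        using that[of z] z q' F(3) by (simp add: insert_absorb add_commute)
    next
      case False
      obtain v where v: "v \<in> Mor C" "Dom C v = Y" "Star C v \<cdot> v = Star C z \<cdot> z \<boxplus> ?G j"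
        by (rule positive_add[of z "g j" Y]) (use z gj in auto)
      have "?S (insert j F) = ?G j \<boxplus> ?S F"
        by (subst E.finsum_insert) (use F j False g' in \<open>auto simp: homset_def\<close>)
      then have "Star C z \<cdot> z \<boxplus> ?S (insert j F) = q \<boxplus> (Star C z \<cdot> z \<boxplus> ?G j)"
        using z(1-3) gj q' F(3)
          add_assoc[of "Star C z \<cdot> z" "?G j" q] add_commute[of q "Star C z \<cdot> z \<boxplus> ?G j"] by simp
      then show thesis using that[of v] v by simp
    qed
    have "?G \<in> insert j F \<rightarrow> carrier (End C Y)" using F j g' by (auto simp: homset_def)
    from E.finsum_closed[OF this] have S: "?S (insert j F) \<in> homset C Y Y" by simp
    have "u \<boxplus> Star C w \<cdot> w = (Star C z \<cdot> z \<boxplus> Star C w \<cdot> w) \<boxplus> ?S (insert j F)"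
      using u(4) y(4) z(4) xx by simp
    also have "\<dots> = (Star C z \<cdot> z \<boxplus> ?S (insert j F)) \<boxplus> Star C w \<cdot> w"
      using S z(1-3) w(1-3) add_commute[of "Star C w \<cdot> w" "?S (insert j F)"]
      by (simp add: add_assoc homset_def)
    finally have "u \<boxplus> Star C w \<cdot> w = (q \<boxplus> Star C v \<cdot> v) \<boxplus> Star C w \<cdot> w" using v(3) by simp
    then have "u = q \<boxplus> Star C v \<cdot> v"
      by (rule add_right_cancel[rotated -1]) (use u(1-3) q' v(1,2) w(1-3) in simp_all)
    then show "q \<sqsubseteq>\<^bsub>herm_order C Y\<^esub> u"
      unfolding herm_order_le_iff[OF Y] using hu q(2) v by auto
  qed
  then have "Star C s \<cdot> s \<sqsubseteq>\<^bsub>herm_order C Y\<^esub> u"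
    using sup by (simp add: has_order_sum_def is_supremum_iff)
  then obtain q where q: "q \<in> Mor C" "Dom C q = Y" "u = Star C s \<cdot> s \<boxplus> Star C q \<cdot> q"
    using herm_order_le_iff[OF Y] by auto
  have "u \<boxplus> (Star C w \<cdot> w \<boxplus> Star C q \<cdot> q) = (u \<boxplus> Star C w \<cdot> w) \<boxplus> Star C q \<cdot> q"
    using u(1-3) w(1-3) q(1,2) by (simp add: add_assoc)
  also have "\<dots> = u" using u(4) q(3) by simp
  finally have "(Star C w \<cdot> w \<boxplus> Star C q \<cdot> q) \<boxplus> u = zero_mor C Y Y \<boxplus> u"
    using u(1-3) w(1-3) q(1,2) add_commute[of u "Star C w \<cdot> w \<boxplus> Star C q \<cdot> q"] by simp
  then have "Star C w \<cdot> w \<boxplus> Star C q \<cdot> q = zero_mor C Y Y"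
    by (rule add_right_cancel[rotated -1]) (use u(1-3) w(1-3) q(1,2) Y in simp_all)
  then have "w = zero_mor C Y (Xs j)"
    using positive_add_eq_zeroD[of w q Y "Xs j"] w(1-3) q(1,2) by simp
  then show ?thesis using w(4) gj by simp
qed

lemma l2_biproduct_mediating:
  assumes oc: "orthogonally_complete C" and bi: "l2_biproduct C J Xs X r"
    and l2: "l2_span C J Xs Y g"
  obtains s where "s \<in> homset C Y X" "\<And>j. j \<in> J \<Longrightarrow> r j \<cdot> s = g j"
    "has_order_sum C Y J (\<lambda>j. Star C (g j) \<cdot> g j) (Star C s \<cdot> s)"
proof -
  note r = l2_biproductD[OF bi]
  have Y: "Y \<in> Ob C" and g: "\<And>j. j \<in> J \<Longrightarrow> g j \<in> homset C Y (Xs j)"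
    using l2 by (auto simp: l2_span_def span_def)
  have g': "g j \<in> Mor C" "Dom C (g j) = Y" "Cod C (g j) = Xs j" if "j \<in> J" for j
    using g[OF that] by (auto simp: homset_def)
  define x where "x j = Star C (r j) \<cdot> g j" for j
  have xjk: "Star C (x j) \<cdot> x k = Star C (g j) \<cdot> ((r j \<cdot> Star C (r k)) \<cdot> g k)" if "j \<in> J" "k \<in> J" for j k
    using r(3-5)[OF that(1)] r(3-5)[OF that(2)] g'[OF that(1)] g'[OF that(2)] by (simp add: x_def)
  have xx: "Star C (x j) \<cdot> x j = Star C (g j) \<cdot> g j" if "j \<in> J" for j
    using xjk[OF that that] r(7)[OF that] g'[OF that] by simp
  have orth: "Star C (x j) \<cdot> x k = zero_mor C Y Y" if "j \<in> J" "k \<in> J" "j \<noteq> k" for j k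
    using xjk[OF that(1,2)] r(8)[OF that] r(6)[OF that(1)] g'[OF that(1)] g'[OF that(2)] Y by simp
  have ps: "partial_sums C Y J (\<lambda>j. Star C (x j) \<cdot> x j) = partial_sums C Y J (\<lambda>j. Star C (g j) \<cdot> g j)"
    by (rule partial_sums_cong[OF Y xx]) (use g' in \<open>auto simp: homset_def\<close>)
  have "l2_family C Y X J x"
    using l2 orth ps r(3-5) g' by (auto simp: l2_family_def l2_span_def homset_def x_def)
  then obtain s where s: "is_order_sum C Y X J x s"
    using ex_order_sum[OF oc Y r(1)] by blast
  then have s': "s \<in> homset C Y X" and sx: "\<And>j. j \<in> J \<Longrightarrow> Star C s \<cdot> x j = Star C (g j) \<cdot> g j"
    and sup: "has_order_sum C Y J (\<lambda>j. Star C (g j) \<cdot> g j) (Star C s \<cdot> s)"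
    using xx ps by (auto simp: is_order_sum_def has_order_sum_def)
  show thesis
    using that[OF s' order_sum_components[OF bi g s' sx[unfolded x_def] sup] sup] by blast
qed

end

theorem proposition4p12:
  fixes C :: "('o, 'm) star_cat"
    and J :: "'j set" and Xs :: "'j \<Rightarrow> 'o" and X :: 'o and r :: "'j \<Rightarrow> 'm"
  assumes "pre_hilbert_star_category C"
    and "monotone_complete C"
    and "orthogonally_complete C"
    and "l2_biproduct C J Xs X r"
  shows "l2_product C J Xs X r"
proof -
  interpret pre_hilbert_star_category C by (rule assms(1))
  note bi = assms(4)
  have "bounded_above C X (partial_sums C X J (\<lambda>j. Star C (r j) \<cdot>\<^bsub>C\<^esub> r j))"
    using l2_biproductD(2)[OF bi] by (auto simp: bounded_above_def is_supremum_iff)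
  then have "l2_span C J Xs X r"
    using bi by (simp add: l2_span_def l2_biproduct_def)
  moreover have "(\<exists>!g. g \<in> homset C Y X \<and> (\<forall>j\<in>J. r j \<cdot>\<^bsub>C\<^esub> g = gs j)) \<and>
      (\<forall>g. g \<in> homset C Y X \<and> (\<forall>j\<in>J. r j \<cdot>\<^bsub>C\<^esub> g = gs j) \<longrightarrow>
        has_order_sum C Y J (\<lambda>j. Star C (gs j) \<cdot>\<^bsub>C\<^esub> gs j) (Star C g \<cdot>\<^bsub>C\<^esub> g))"
    if gs: "l2_span C J Xs Y gs" for Y gs
  proof -
    obtain s where s: "s \<in> homset C Y X" "\<And>j. j \<in> J \<Longrightarrow> r j \<cdot>\<^bsub>C\<^esub> s = gs j"
      "has_order_sum C Y J (\<lambda>j. Star C (gs j) \<cdot>\<^bsub>C\<^esub> gs j) (Star C s \<cdot>\<^bsub>C\<^esub> s)"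
      by (fact l2_biproduct_mediating[OF assms(3) bi gs])
    have "g = s" if "g \<in> homset C Y X" "\<forall>j\<in>J. r j \<cdot>\<^bsub>C\<^esub> g = gs j" for g
      by (rule l2_biproduct_unique[OF bi that(1) s(1)]) (use that(2) s(2) in simp)
    then show ?thesis using s by blast
  qed
  ultimately show ?thesis by (simp add: l2_product_def)
qed

end
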